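(* There is an absolute constant $c>0$ such that for all sufficiently large $n$ the following holds. Let $P_1,\dots,P_n\colon\mathbb{F}_2^m\to\mathbb{F}_2$ be polynomials of degree at most $3$ and let $\mathcal{P}$ be the distribution of $(P_1(X),\dots,P_n(X))$ for $X$ uniform on $\mathbb{F}_2^m$. Then \[ \|\mathcal{P}-\mathrm{Ber}(1/3)^{\otimes n}\|_{\mathtt{TV}}\ \ge\ 1-2^{-c\sqrt{\log\log n}}. \]
   Context: Logarithms are base 2. Total variation distance: $\frac12\sum_x|\mathcal{D}_1(x)-\mathcal{D}_2(x)|$; $\mathrm{Ber}(1/3)^{\otimes n}$ is the product of $n$ independent Bernoulli$(1/3)$ bits. *)

theory Defs
  imports Complex_Main
begin

text \<open>Points of F_2^k: functions nat => bool vanishing outside {..<k}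
  (True = 1, False = 0).\<close>
definition cube :: "nat \<Rightarrow> (nat \<Rightarrow> bool) set" where
  "cube k = {x. \<forall>i\<ge>k. \<not> x i}"

text \<open>f : F_2^m -> F_2 is a polynomial of degree at most d: it agrees on F_2^m
  with a sum over F_2 of monomials prod_{i in S} x_i, S a subset of {..<m}, |S| <= d.
  (Every polynomial over F_2 restricts on F_2^m to such a multilinear one of no
  larger degree, since x_i^2 = x_i.)\<close>
definition f2_poly_deg_le :: "nat \<Rightarrow> nat \<Rightarrow> ((nat \<Rightarrow> bool) \<Rightarrow> bool) \<Rightarrow> bool" where
  "f2_poly_deg_le m d f \<longleftrightarrow>
     (\<exists>C. C \<subseteq> {S. S \<subseteq> {..<m} \<and> card S \<le> d} \<and>
          (\<forall>x\<in>cube m. f x = odd (card {S\<in>C. \<forall>i\<in>S. x i})))"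

definition poly_dist :: "nat \<Rightarrow> nat \<Rightarrow> (nat \<Rightarrow> (nat \<Rightarrow> bool) \<Rightarrow> bool) \<Rightarrow> (nat \<Rightarrow> bool) \<Rightarrow> real" where
  "poly_dist m n P y =
     real (card {x\<in>cube m. (\<lambda>i. if i < n then P i x else False) = y}) / 2 ^ m"

definition ber13_prod :: "nat \<Rightarrow> (nat \<Rightarrow> bool) \<Rightarrow> real" where
  "ber13_prod n y = (1/3) ^ card {i. i < n \<and> y i} * (2/3) ^ (n - card {i. i < n \<and> y i})"

definition tv_dist :: "nat \<Rightarrow> ((nat \<Rightarrow> bool) \<Rightarrow> real) \<Rightarrow> ((nat \<Rightarrow> bool) \<Rightarrow> real) \<Rightarrow> real" where
  "tv_dist n D1 D2 = (1/2) * (\<Sum>y\<in>cube n. \<bar>D1 y - D2 y\<bar>)"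

end

theory Submission
  imports Defs "HOL-Library.Z2" "HOL-Library.Function_Algebras" "HOL-Computational_Algebra.Primes"
    "HOL-Analysis.Elementary_Normed_Spaces" "HOL-Real_Asymp.Real_Asymp"
begin

text \<open>
  Write bias for the mean of \<open>(-1)^f\<close>. A cubic over \<open>F\<^sub>2\<close> cannot have bias close to 1/3: if its bias
  is at least 1/4, its third derivative is a trilinear form of small rank in many directions, hence
  vanishes on a subgroup of bounded index, on whose cosets the cubic is quadratic. Quadratic biases
  are 0 or plus or minus a power of 1/2, so the biases in question form a compact set of dyadic
  rationals, which stays at a distance \<open>\<eta>\<close> from 1/3.

  Let \<open>\<epsilon>\<close> be the total mass of the minimum of the two distributions, and let \<open>w\<close> be the corresponding
  weight on the inputs, of mean \<open>\<epsilon>\<close>. In a random parallelepiped of dimension \<open>d\<close> the product of the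
  weights of the \<open>2^d\<close> vertices has mean at least \<open>\<epsilon>^(2^d)\<close> (as for Gowers norms), and any two
  vertices are independent. Under \<open>w(x) w(y)\<close> the outputs at \<open>x\<close> and \<open>y\<close> are dominated by two
  independent samples of the product distribution, whose centred correlation is of order
  \<open>1/sqrt n\<close>. If \<open>\<epsilon>^(2^d)\<close> were much larger than \<open>1/sqrt n\<close>, then on some parallelepiped the mean over
  \<open>j\<close> of the square of (bias of \<open>P\<^sub>j\<close> minus 1/3) would be about \<open>2^-d\<close>; for constant \<open>d\<close> large in
  terms of \<open>\<eta>\<close> this contradicts the gap. Thus \<open>\<epsilon>\<close> is at most a negative power of \<open>n\<close>.
\<close>

declare add_bit_eq_xor [simp del] mult_bit_eq_and [simp del]

section \<open>Groups of exponent two, in the role of vector spaces over F_2\<close>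

class char2_group = ab_group_add +
  assumes add_self [simp]: "x + x = 0"
begin

lemma add_self_left [simp]: "x + (x + y) = y"
  by (simp flip: add.assoc)

lemma add_eq_0_iff_eq [simp]: "x + y = 0 \<longleftrightarrow> x = y"
  by (metis add_self add_left_cancel)

end

instance bit :: char2_group
proof
  show "x + x = 0" for x :: bit by (cases x) (auto simp: add_bit_eq_xor)
qed

instance "fun" :: (type, char2_group) char2_group
  by standard (simp add: fun_eq_iff)

section \<open>Finite subgroups\<close>

text \<open>Finiteness is built in because cardinality takes the place of dimension. Every element
  is its own inverse, so closure under addition gives a subgroup.\<close>

definition subgrp :: "'v::char2_group set \<Rightarrow> bool" where
  "subgrp V \<longleftrightarrow> finite V \<and> 0 \<in> V \<and> (\<forall>x\<in>V. \<forall>y\<in>V. x + y \<in> V)"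

lemma subgrp_finite: "subgrp V \<Longrightarrow> finite V"
  and subgrp_0: "subgrp V \<Longrightarrow> 0 \<in> V"
  and subgrp_add: "subgrp V \<Longrightarrow> x \<in> V \<Longrightarrow> y \<in> V \<Longrightarrow> x + y \<in> V"
  by (auto simp: subgrp_def)

lemma subgrp_card_pos: "subgrp V \<Longrightarrow> card V > 0"
  by (auto simp: subgrp_def card_gt_0_iff)

lemma subgrp_Int: "subgrp V \<Longrightarrow> subgrp W \<Longrightarrow> subgrp (V \<inter> W)"
  by (auto simp: subgrp_def)

lemma subgrp_trivial: "subgrp {0}"
  by (simp add: subgrp_def)

lemma sum_subgrp_translate:
  fixes g :: "'v::char2_group \<Rightarrow> 'b::comm_monoid_add"
  assumes "subgrp V" "a \<in> V"
  shows "(\<Sum>x\<in>V. g (x + a)) = (\<Sum>x\<in>V. g x)"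
  by (rule sum.reindex_bij_witness[of _ "\<lambda>x. x + a" "\<lambda>x. x + a"])
     (use assms in \<open>auto simp: subgrp_add add.assoc\<close>)

text \<open>Passing from U to the union of U and the coset of v takes the place of adjoining a basis
  vector.\<close>

lemma subgrp_double:
  assumes U: "subgrp U" and v: "v \<notin> U"
  shows "subgrp (U \<union> (+) v ` U)" "U \<inter> (+) v ` U = {}" "card (U \<union> (+) v ` U) = 2 * card U"
proof -
  note U' = subgrp_finite[OF U] subgrp_0[OF U] subgrp_add[OF U]
  have "v + x + y \<in> (+) v ` U" "x + (v + y) \<in> (+) v ` U" "v + x + (v + y) \<in> U"
    if "x \<in> U" "y \<in> U" for x y
  proof -
    have "v + x + (v + y) = x + y" by (simp add: ac_simps)
    then show "v + x + (v + y) \<in> U" using that U'(3) by metis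
    show "v + x + y \<in> (+) v ` U" "x + (v + y) \<in> (+) v ` U"
      using that U' by (auto simp: add.assoc add.left_commute[of x])
  qed
  then show "subgrp (U \<union> (+) v ` U)"
    unfolding subgrp_def using U' by auto
  show disj: "U \<inter> (+) v ` U = {}"
  proof (rule ccontr)
    assume "U \<inter> (+) v ` U \<noteq> {}"
    then obtain x where x: "x \<in> U" "v + x \<in> U" by auto
    have "v = x + (v + x)" by (simp add: add.left_commute[of x])
    then show False using v U' x by metis
  qed
  have "card ((+) v ` U) = card U" by (rule card_image) (simp add: inj_on_def)
  then show "card (U \<union> (+) v ` U) = 2 * card U"
    using card_Un_disjoint[OF U'(1) _ disj] U'(1) by simp
qed

text \<open>A subgroup of maximal order among those satisfying \<open>P\<close> must be everything, since
  otherwise it can be doubled.\<close>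

lemma subgrp_double_induct [consumes 3, case_names base double]:
  fixes V :: "'v::char2_group set"
  assumes V: "subgrp V" and U: "subgrp U" "U \<subseteq> V"
    and base: "P U"
    and double: "\<And>W v. subgrp W \<Longrightarrow> U \<subseteq> W \<Longrightarrow> W \<subseteq> V \<Longrightarrow> v \<in> V \<Longrightarrow> v \<notin> W \<Longrightarrow> P W \<Longrightarrow> P (W \<union> (+) v ` W)"
  shows "P V"
proof -
  let ?F = "{W. subgrp W \<and> U \<subseteq> W \<and> W \<subseteq> V \<and> P W}"
  have fin: "finite ?F" by (rule finite_subset[of _ "Pow V"]) (use V in \<open>auto simp: subgrp_def\<close>)
  have "?F \<noteq> {}" using U base by auto
  then have "\<exists>W\<in>?F. \<forall>W'\<in>?F. W \<subseteq> W' \<longrightarrow> W = W'" by (rule finite_has_maximal[OF fin])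
  then obtain W where W: "W \<in> ?F" "\<forall>W'\<in>?F. W \<subseteq> W' \<longrightarrow> W = W'" by (rule bexE)
  have "W = V"
  proof (rule ccontr)
    assume "W \<noteq> V"
    then obtain v where v: "v \<in> V" "v \<notin> W" using W by auto
    have "(+) v ` W \<subseteq> V" using v W V by (auto intro: subgrp_add)
    then have "W \<union> (+) v ` W \<in> ?F" using W(1) v double[of W v] subgrp_double(1)[of W v] by auto
    then have "W = W \<union> (+) v ` W" using W(2) by (meson Un_upper1)
    moreover have "v \<in> (+) v ` W" using W(1) by (auto simp: subgrp_def image_iff intro!: bexI[of _ 0])
    ultimately show False using v by blast
  qed
  then show ?thesis using W by auto
qed

lemma card_subgrp_pow2:
  assumes "subgrp V" "subgrp U" "U \<subseteq> V"
  shows "\<exists>k. card V = 2 ^ k * card U"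
  using assms
proof (induction rule: subgrp_double_induct)
  case base
  show ?case by (rule exI[of _ 0]) simp
next
  case (double W v)
  then obtain k where "card W = 2 ^ k * card U" by auto
  then show ?case using subgrp_double(3)[of W v] double by (intro exI[of _ "Suc k"]) simp
qed

lemma card_subgrp_eq_pow2: "subgrp V \<Longrightarrow> \<exists>k. card V = 2 ^ k"
  using card_subgrp_pow2[of V "{0}"] by (simp add: subgrp_0 subgrp_trivial)

text \<open>One half of the product formula for subgroups. Fix for each s in the sumset a
  decomposition with first component \<open>r s\<close>. A pair (w, k) is recovered from s = w + k
  and the discrepancy w + \<open>r s\<close>, which lies in both subgroups.\<close>

lemma card_sumset_Int:
  assumes W: "subgrp W" and K: "subgrp K"
  shows "card W * card K \<le> card {w + k |w k. w \<in> W \<and> k \<in> K} * card (W \<inter> K)"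
proof -
  let ?S = "{w + k |w k. w \<in> W \<and> k \<in> K}"
  note f = subgrp_finite[OF W] subgrp_finite[OF K]
  have "\<forall>s\<in>?S. \<exists>w. w \<in> W \<and> w + s \<in> K"
  proof
    fix s assume "s \<in> ?S"
    then obtain w k where "w \<in> W" "k \<in> K" "s = w + k" by auto
    then show "\<exists>w. w \<in> W \<and> w + s \<in> K" by (intro exI[of _ w]) simp
  qed
  from bchoice[OF this] obtain r where "\<forall>s\<in>?S. r s \<in> W \<and> r s + s \<in> K" ..
  then have r: "r s \<in> W" "r s + s \<in> K" if "s \<in> ?S" for s
    using that by (simp_all only: Ball_def)
  let ?g = "\<lambda>(w, k). (w + k, w + r (w + k))"
  have "inj_on ?g (W \<times> K)"
    by (auto simp: inj_on_def)
  moreover have "?g ` (W \<times> K) \<subseteq> ?S \<times> (W \<inter> K)"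
  proof clarify
    fix w k assume wk: "w \<in> W" "k \<in> K"
    then have s: "w + k \<in> ?S" by blast
    have "w + r (w + k) \<in> W" using r(1)[OF s] wk W by (auto intro: subgrp_add)
    moreover have "w + r (w + k) = (r (w + k) + (w + k)) + k" by (simp add: ac_simps)
    then have "w + r (w + k) \<in> K" using r(2)[OF s] wk K by (metis subgrp_add)
    ultimately show "(w + k \<in> ?S) \<and> w + r (w + k) \<in> W \<inter> K" using s by blast
  qed
  moreover have "finite (?S \<times> (W \<inter> K))"
    using f by (auto intro!: finite_cartesian_product finite_image_set2)
  ultimately have "card (W \<times> K) \<le> card (?S \<times> (W \<inter> K))"
    by (rule card_inj_on_le)
  then show ?thesis by (simp add: card_cartesian_product)
qed

lemma subgrp_sumset:
  assumes W: "subgrp W" and K: "subgrp K"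
  shows "subgrp {w + k |w k. w \<in> W \<and> k \<in> K}"
  unfolding subgrp_def
proof (intro conjI ballI)
  show "finite {w + k |w k. w \<in> W \<and> k \<in> K}"
    using W K by (auto intro!: finite_image_set2 simp: subgrp_def)
  show "0 \<in> {w + k |w k. w \<in> W \<and> k \<in> K}"
    using W K by (intro CollectI exI[of _ 0]) (simp add: subgrp_0)
  fix x y
  assume "x \<in> {w + k |w k. w \<in> W \<and> k \<in> K}" "y \<in> {w + k |w k. w \<in> W \<and> k \<in> K}"
  then obtain w k w' k' where "w \<in> W" "k \<in> K" "w' \<in> W" "k' \<in> K" "x = w + k" "y = w' + k'" by auto
  then show "x + y \<in> {w + k |w k. w \<in> W \<and> k \<in> K}"
    using W K by (intro CollectI exI[of _ "w + w'"] exI[of _ "k + k'"]) (simp add: subgrp_add ac_simps)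
qed

text \<open>In terms of indices in V: the index of an intersection is at most the product of the
  indices. This is how codimensions are added below.\<close>

lemma card_Int_subgrp:
  assumes "subgrp V" "subgrp W" "subgrp K" "W \<subseteq> V" "K \<subseteq> V"
  shows "card W * card K \<le> card V * card (W \<inter> K)"
proof -
  have "{w + k |w k. w \<in> W \<and> k \<in> K} \<subseteq> V" using assms by (auto intro: subgrp_add)
  then have "card {w + k |w k. w \<in> W \<and> k \<in> K} \<le> card V"
    using assms by (auto intro: card_mono simp: subgrp_def)
  then show ?thesis using card_sumset_Int[OF assms(2,3)]
    by (meson le_trans mult_le_mono1)
qed

text \<open>By doubling less than 3/2, two elements \<open>x\<close>, \<open>y\<close> of \<open>B + B\<close> satisfy
  \<open>c + x, c + y \<in> B\<close> for a common \<open>c \<in> B\<close>.\<close>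

lemma subgrp_small_doubling:
  fixes B :: "'v::char2_group set"
  assumes fin: "finite B" and ne: "B \<noteq> {}" and S: "S = {b + c |b c. b \<in> B \<and> c \<in> B}"
    and small: "2 * card S < 3 * card B"
  shows "subgrp S"
proof -
  have finS: "finite S" unfolding S using fin by (auto intro!: finite_image_set2)
  \<comment> \<open>Write x = b + b'. The translates of B by b and by b' both lie in S, and two sets
    of size |B| among fewer than 3|B|/2 elements share more than |B|/2 of them.\<close>
  have half: "2 * card {c\<in>B. c + x \<in> B} > card B" if x: "x \<in> S" for x
  proof -
    obtain b b' where b: "b \<in> B" "b' \<in> B" "x = b + b'" using x S by auto
    let ?P = "(+) b ` B" and ?Q = "(+) b' ` B"
    have sub: "?P \<union> ?Q \<subseteq> S" using b S by blast
    have c: "card ?P = card B" "card ?Q = card B" by (auto intro!: card_image simp: inj_on_def)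
    have "card ?P + card ?Q = card (?P \<union> ?Q) + card (?P \<inter> ?Q)"
      using fin by (intro card_Un_Int) auto
    then have "2 * card (?P \<inter> ?Q) > card B"
      using card_mono[OF finS sub] small by (simp only: c)
    moreover have "?P \<inter> ?Q \<subseteq> (+) b ` {c\<in>B. c + x \<in> B}"
    proof
      fix z assume "z \<in> ?P \<inter> ?Q"
      then obtain c d where cd: "c \<in> B" "d \<in> B" "z = b + c" "z = b' + d" by auto
      have "c = b + z" using cd(3) by simp
      have "c + x = b' + z" unfolding \<open>c = b + z\<close> b(3) by (simp add: ac_simps)
      then have "c + x = d" using cd(4) by simp
      then show "z \<in> (+) b ` {c\<in>B. c + x \<in> B}" using cd by auto
    qed
    then have "card (?P \<inter> ?Q) \<le> card {c\<in>B. c + x \<in> B}"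
      using fin by (intro surj_card_le) auto
    ultimately show ?thesis by (meson less_le_trans mult_le_mono2)
  qed
  have "x + y \<in> S" if x: "x \<in> S" and y: "y \<in> S" for x y
  proof -
    let ?P = "{c\<in>B. c + x \<in> B}" and ?Q = "{c\<in>B. c + y \<in> B}"
    have "?P \<inter> ?Q \<noteq> {}"
    proof
      assume e: "?P \<inter> ?Q = {}"
      have "card ?P + card ?Q = card (?P \<union> ?Q)" using card_Un_disjoint[OF _ _ e] fin by simp
      also have "\<dots> \<le> card B" using fin by (intro card_mono) auto
      finally show False using half[OF x] half[OF y] by linarith
    qed
    then obtain c where c: "c + x \<in> B" "c + y \<in> B" by auto
    have e: "(c + x) + (c + y) = x + y" by (simp add: ac_simps)
    have "(c + x) + (c + y) \<in> S" unfolding S using c by blast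
    then show ?thesis unfolding e .
  qed
  moreover obtain b where "b \<in> B" using ne by blast
  then have "0 \<in> S" unfolding S by (intro CollectI exI[of _ b]) simp
  ultimately show ?thesis using finS by (auto simp: subgrp_def)
qed

section \<open>Derivatives and degree\<close>

definition diff :: "'v::char2_group \<Rightarrow> ('v \<Rightarrow> bit) \<Rightarrow> 'v \<Rightarrow> bit" where
  "diff h f x = f (x + h) + f x"

text \<open>Degree is measured by derivatives, in directions from V only: all k-fold derivatives are
  constant on V. This notion passes to subgroups and translates without any choice of
  coordinates.\<close>

fun deg_le :: "nat \<Rightarrow> 'v::char2_group set \<Rightarrow> ('v \<Rightarrow> bit) \<Rightarrow> bool" where
  "deg_le 0 V f \<longleftrightarrow> (\<exists>c. \<forall>x\<in>V. f x = c)"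
| "deg_le (Suc k) V f \<longleftrightarrow> (\<forall>h\<in>V. deg_le k V (diff h f))"

lemma deg_le_0_D: "subgrp V \<Longrightarrow> deg_le 0 V f \<Longrightarrow> x \<in> V \<Longrightarrow> f x = f 0"
  by (auto simp: subgrp_0)

lemma deg_le_0_I: "(\<And>x. x \<in> V \<Longrightarrow> f x = f 0) \<Longrightarrow> deg_le 0 V f"
  by auto

lemma diff_commute: "diff h (diff k f) = diff k (diff h f)"
  by (auto simp: diff_def fun_eq_iff ac_simps)

text \<open>The cocycle rule. It makes the kernels \<open>dker\<close> subgroups and the third
  derivative of a cubic additive.\<close>

lemma diff_add: "diff (h + k) f x = diff h f (x + k) + diff k f x"
proof -
  have "diff h f (x + k) + diff k f x = f (x + k + h) + f x + (f (x + k) + f (x + k))"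
    unfolding diff_def by (simp only: ac_simps)
  then show ?thesis by (simp add: diff_def ac_simps)
qed

lemma diff_translate: "diff h (\<lambda>x. f (a + x)) = (\<lambda>x. diff h f (a + x))"
  by (auto simp: diff_def fun_eq_iff add.assoc)

lemma diff_sum: "diff h (\<lambda>x. f x + g x) = (\<lambda>x. diff h f x + diff h g x)"
  by (auto simp: diff_def fun_eq_iff ac_simps)

lemma deg_le_cong:
  assumes "subgrp V" "\<And>x. x \<in> V \<Longrightarrow> f x = g x" "deg_le k V f"
  shows "deg_le k V g"
  using assms(2,3)
proof (induction k arbitrary: f g)
  case 0
  then obtain c where "\<forall>x\<in>V. f x = c" by auto
  then have "\<forall>x\<in>V. g x = c" using 0(1) by simp
  then show ?case by auto
next
  case (Suc k)
  have "deg_le k V (diff h g)" if "h \<in> V" for h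
  proof (rule Suc.IH)
    show "diff h f x = diff h g x" if "x \<in> V" for x
      using Suc.prems(1) that \<open>h \<in> V\<close> assms(1) by (simp add: diff_def subgrp_add)
    show "deg_le k V (diff h f)" using Suc.prems(2) that by simp
  qed
  then show ?case by simp
qed

lemma deg_le_translate:
  assumes "subgrp V" "a \<in> V" "deg_le k V f"
  shows "deg_le k V (\<lambda>x. f (a + x))"
  using assms(3)
proof (induction k arbitrary: f)
  case 0
  then obtain c where "\<forall>x\<in>V. f x = c" by auto
  then have "\<forall>x\<in>V. f (a + x) = c" using assms by (simp add: subgrp_add)
  then show ?case by auto
next
  case (Suc k)
  then show ?case by (simp add: diff_translate)
qed

lemma deg_le_subset: "deg_le k V f \<Longrightarrow> U \<subseteq> V \<Longrightarrow> deg_le k U f"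
  by (induction k arbitrary: f) auto

lemma deg_le_add: "deg_le k V f \<Longrightarrow> deg_le k V g \<Longrightarrow> deg_le k V (\<lambda>x. f x + g x)"
proof (induction k arbitrary: f g)
  case 0
  then obtain c d where "\<forall>x\<in>V. f x = c" "\<forall>x\<in>V. g x = d" by auto
  then have "\<forall>x\<in>V. f x + g x = c + d" by simp
  then show ?case by auto
qed (simp add: diff_sum)

lemma deg_le_Suc: "subgrp V \<Longrightarrow> deg_le k V f \<Longrightarrow> deg_le (Suc k) V f"
proof (induction k arbitrary: f)
  case 0
  then have "diff h f x = 0" if "x \<in> V" "h \<in> V" for x h
    using that subgrp_add[OF 0(1) that] 0(2) by (auto simp: diff_def)
  then show ?case by auto
next
  case (Suc k)
  have "deg_le (Suc k) V (diff h f)" if "h \<in> V" for h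
    using Suc that by auto
  then show ?case using deg_le.simps(2) by blast
qed

section \<open>Bias\<close>

definition chi :: "bit \<Rightarrow> real" where
  "chi b = (if b = 0 then 1 else -1)"

lemma chi_add: "chi (a + b) = chi a * chi b"
  by (cases a; cases b) (auto simp: chi_def)

lemma chi_simps [simp]: "chi 0 = 1" "chi 1 = -1" "chi a * chi a = 1" "\<bar>chi a\<bar> = 1"
  by (auto simp: chi_def)

definition bias :: "'v::char2_group set \<Rightarrow> ('v \<Rightarrow> bit) \<Rightarrow> real" where
  "bias V f = (\<Sum>x\<in>V. chi (f x)) / real (card V)"

lemma abs_bias_le_1:
  assumes "subgrp V"
  shows "\<bar>bias V f\<bar> \<le> 1"
proof -
  have "\<bar>\<Sum>x\<in>V. chi (f x)\<bar> \<le> (\<Sum>x\<in>V. \<bar>chi (f x)\<bar>)" by (rule sum_abs)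
  then have "\<bar>\<Sum>x\<in>V. chi (f x)\<bar> \<le> real (card V)" by simp
  then show ?thesis using subgrp_card_pos[OF assms] by (simp add: bias_def)
qed

lemma bias_double:
  assumes "subgrp U" "v \<notin> U"
  shows "bias (U \<union> (+) v ` U) f = (bias U f + bias U (\<lambda>x. f (v + x))) / 2"
proof -
  have "(\<Sum>x\<in>U \<union> (+) v ` U. chi (f x)) = (\<Sum>x\<in>U. chi (f x)) + (\<Sum>x\<in>(+) v ` U. chi (f x))"
    using assms subgrp_double(2)[OF assms] by (intro sum.union_disjoint) (auto simp: subgrp_def)
  also have "(\<Sum>x\<in>(+) v ` U. chi (f x)) = (\<Sum>x\<in>U. chi (f (v + x)))"
    by (subst sum.reindex) (auto simp: inj_on_def)
  finally show ?thesis
    using subgrp_double(3)[OF assms] by (simp add: bias_def add_divide_distrib)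
qed

text \<open>Weyl differencing: expand the square and substitute y = x + h. The derivatives on the
  right have smaller degree than f.\<close>

lemma bias_square:
  assumes "subgrp V"
  shows "(bias V f)\<^sup>2 = (\<Sum>h\<in>V. bias V (diff h f)) / real (card V)"
proof -
  have "(\<Sum>x\<in>V. chi (f x))\<^sup>2 = (\<Sum>x\<in>V. \<Sum>y\<in>V. chi (f x) * chi (f y))"
    by (simp add: power2_eq_square sum_product)
  also have "\<dots> = (\<Sum>x\<in>V. \<Sum>h\<in>V. chi (f x) * chi (f (x + h)))"
  proof (rule sum.cong[OF refl])
    fix x assume "x \<in> V"
    then show "(\<Sum>y\<in>V. chi (f x) * chi (f y)) = (\<Sum>h\<in>V. chi (f x) * chi (f (x + h)))"
      using sum_subgrp_translate[OF assms, of x "\<lambda>y. chi (f x) * chi (f y)"]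
      by (simp add: add.commute)
  qed
  also have "\<dots> = (\<Sum>h\<in>V. \<Sum>x\<in>V. chi (diff h f x))"
    by (subst sum.swap) (simp add: diff_def chi_add mult.commute)
  finally show ?thesis
    by (simp add: bias_def power_divide power2_eq_square flip: sum_divide_distrib)
qed

lemma bias_deg_0:
  assumes "subgrp V" "deg_le 0 V f"
  shows "bias V f = chi (f 0)"
proof -
  have "(\<Sum>x\<in>V. chi (f x)) = (\<Sum>x\<in>V. chi (f 0))"
    by (intro sum.cong refl arg_cong[of _ _ chi] deg_le_0_D[OF assms])
  then show ?thesis using subgrp_card_pos[OF assms(1)] by (simp add: bias_def)
qed

text \<open>Some derivative in a direction h is constantly 1, so translation by h flips the sign of
  every summand.\<close>

lemma bias_deg_1:
  assumes V: "subgrp V" and f: "deg_le 1 V f" "\<not> deg_le 0 V f"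
  shows "bias V f = 0"
proof -
  have "\<exists>h\<in>V. diff h f 0 = 1"
  proof (rule ccontr)
    assume "\<not> ?thesis"
    then have "\<And>h. h \<in> V \<Longrightarrow> diff h f 0 = 0" by auto
    then have "\<And>h. h \<in> V \<Longrightarrow> f h = f 0" by (simp add: diff_def)
    then show False using f(2) deg_le_0_I by blast
  qed
  then obtain h where h: "h \<in> V" "diff h f 0 = 1" by blast
  have "diff h f x = 1" if "x \<in> V" for x
  proof -
    have "diff h f x = diff h f 0" using f(1) h(1) that deg_le_0_D[OF V] by simp
    then show ?thesis using h(2) by simp
  qed
  note * = this
  have **: "chi (f (x + h)) = - chi (f x)" if "x \<in> V" for x
  proof -
    have "f (x + h) + f x = 1" using *[OF that] by (simp add: diff_def)
    then show ?thesis by (cases "f (x + h)"; cases "f x") simp_all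
  qed
  have "(\<Sum>x\<in>V. chi (f x)) = (\<Sum>x\<in>V. chi (f (x + h)))"
    by (rule sum_subgrp_translate[OF V h(1), symmetric])
  also have "\<dots> = - (\<Sum>x\<in>V. chi (f x))"
    by (simp add: ** sum_negf)
  finally show ?thesis by (simp add: bias_def)
qed

text \<open>For quadratic f this is the radical of the associated bilinear form.\<close>

definition dker :: "'v::char2_group set \<Rightarrow> ('v \<Rightarrow> bit) \<Rightarrow> 'v set" where
  "dker V f = {h\<in>V. deg_le 0 V (diff h f)}"

lemma subgrp_dker:
  assumes V: "subgrp V"
  shows "subgrp (dker V f)"
proof -
  have "deg_le 0 V (diff (h + k) f)" if "h \<in> dker V f" "k \<in> dker V f" for h k
  proof -
    have "diff (h + k) f = (\<lambda>x. diff h f (k + x) + diff k f x)"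
      by (auto simp: diff_add add.commute)
    moreover have "deg_le 0 V (\<lambda>x. diff h f (k + x))" "deg_le 0 V (diff k f)"
      using that deg_le_translate[OF V, of k 0 "diff h f"] unfolding dker_def by blast+
    ultimately show ?thesis using deg_le_add[of 0 V] by simp
  qed
  moreover have "deg_le 0 V (diff 0 f)" by (auto simp: diff_def)
  ultimately show ?thesis
    using V by (simp add: subgrp_def dker_def del: deg_le.simps)
qed

text \<open>Derivatives of a quadratic are affine, so after differencing only directions in the
  radical contribute, each with a sign. On the radical the exponent of this sign is an affine
  function vanishing at 0: the signs cancel, or all of them are 1.\<close>

lemma bias_square_deg_2:
  assumes V: "subgrp V" and f: "deg_le 2 V f"
  shows "(bias V f)\<^sup>2 = 0 \<or> (bias V f)\<^sup>2 = real (card (dker V f)) / real (card V)"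
proof -
  let ?R = "dker V f"
  note R = subgrp_dker[OF V, of f]
  have RV: "?R \<subseteq> V" by (auto simp: dker_def)
  define g where "g h = diff h f 0" for h
  have bias: "bias V (diff h f) = (if h \<in> ?R then chi (g h) else 0)" if "h \<in> V" for h
    using bias_deg_0[OF V, of "diff h f"] bias_deg_1[OF V, of "diff h f"] f that
    by (auto simp: dker_def g_def numeral_2_eq_2)
  have "(\<Sum>h\<in>V. bias V (diff h f)) = (\<Sum>h\<in>V. if h \<in> ?R then chi (g h) else 0)"
    by (intro sum.cong refl bias)
  also have "\<dots> = (\<Sum>h\<in>?R. chi (g h))"
    using V RV by (subst sum.inter_restrict[symmetric]) (auto simp: subgrp_def Int_absorb1)
  finally have 1: "(bias V f)\<^sup>2 = bias ?R g * real (card ?R) / real (card V)"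
    using bias_square[OF V, of f] subgrp_card_pos[OF R] by (simp add: bias_def)
  have "diff k g x = diff k f 0" if "k \<in> ?R" "x \<in> ?R" for k x
  proof -
    have "diff k g x = diff k f x"
      by (simp add: g_def diff_def ac_simps)
    also have "\<dots> = diff k f 0" using that by (intro deg_le_0_D[OF V]) (auto simp: dker_def)
    finally show ?thesis .
  qed
  then have deg1: "deg_le 1 ?R g" by auto
  have g0: "g 0 = 0" by (simp add: g_def diff_def)
  show ?thesis
    using bias_deg_1[OF R deg1] bias_deg_0[OF R, of g] g0 1 by (cases "deg_le 0 ?R g") auto
qed

text \<open>The formula for the square alone would admit odd powers of 1/sqrt 2. They are excluded
  because the character sum is an integer whose square is a power of two, hence up to sign a power
  of two itself.\<close>

lemma bias_deg_2:
  assumes V: "subgrp V" and f: "deg_le 2 V f"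
  shows "bias V f \<in> insert 0 (range (\<lambda>j::nat. (1/2)^j) \<union> range (\<lambda>j::nat. -((1/2)^j)))"
proof (cases "bias V f = 0")
  case False
  let ?S = "\<Sum>x\<in>V. chi (f x)"
  obtain a where a: "card V = 2 ^ a" using card_subgrp_eq_pow2[OF V] by auto
  obtain b where b: "card (dker V f) = 2 ^ b" using card_subgrp_eq_pow2[OF subgrp_dker[OF V]] by auto
  have "?S = of_int (\<Sum>x\<in>V. if f x = 0 then 1 else -1)"
    unfolding of_int_sum by (intro sum.cong) (auto simp: chi_def)
  then obtain z where z: "?S = of_int z" by blast
  have "(?S / 2 ^ a)\<^sup>2 = 2 ^ b / 2 ^ a"
    using bias_square_deg_2[OF V f] False a b by (auto simp: bias_def)
  then have "?S\<^sup>2 = 2 ^ (a + b)"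
    by (simp add: power_divide field_simps power2_eq_square power_add)
  then have "of_int (z\<^sup>2) = (of_int (2 ^ (a + b)) :: real)" unfolding z by simp
  then have "z\<^sup>2 = 2 ^ (a + b)" by (simp only: of_int_eq_iff)
  then have "\<bar>z\<bar> dvd 2 ^ (a + b)" by (metis abs_dvd_iff dvd_triv_left power2_eq_square)
  then have "nat \<bar>z\<bar> dvd 2 ^ (a + b)" by (simp add: nat_dvd_iff)
  then obtain c where "nat \<bar>z\<bar> = 2 ^ c" using divides_primepow_nat two_is_prime_nat by blast
  then have zc: "\<bar>z\<bar> = 2 ^ c" by (metis nat_eq_iff of_nat_numeral of_nat_power abs_ge_zero)
  have Sc: "\<bar>?S\<bar> = 2 ^ c" unfolding z by (metis zc of_int_abs of_int_numeral of_int_power)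
  have "\<bar>?S\<bar> \<le> 2 ^ a"
    using abs_bias_le_1[OF V, of f] a by (simp add: bias_def)
  then have "c \<le> a" using Sc by simp
  then have "\<bar>bias V f\<bar> = (1/2) ^ (a - c)"
    using Sc a by (simp add: bias_def power_diff power_divide)
  then show ?thesis by (auto simp: abs_if split: if_splits intro: range_eqI)
    (metis (no_types, lifting) add.inverse_inverse rangeI)
qed simp

section \<open>Symmetric trilinear forms of small rank\<close>

text \<open>The radical of the bilinear form \<open>T h\<close> restricted to U; its index in U
  stands for 2 to the rank.\<close>

definition tker :: "('v::char2_group \<Rightarrow> 'v \<Rightarrow> 'v \<Rightarrow> bit) \<Rightarrow> 'v set \<Rightarrow> 'v \<Rightarrow> 'v set" where
  "tker T U h = {x\<in>U. \<forall>y\<in>U. T h x y = 0}"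

text \<open>Additivity in one argument together with two transpositions yields full symmetric
  trilinearity. It is asked for on V only, where the third derivative of a cubic has it.\<close>

locale symmetric_trilinear =
  fixes V :: "'v::char2_group set" and T :: "'v \<Rightarrow> 'v \<Rightarrow> 'v \<Rightarrow> bit"
  assumes V: "subgrp V"
    and add1: "\<And>h k x y. \<lbrakk>h \<in> V; k \<in> V; x \<in> V; y \<in> V\<rbrakk> \<Longrightarrow> T (h + k) x y = T h x y + T k x y"
    and swap12: "\<And>h k x. \<lbrakk>h \<in> V; k \<in> V; x \<in> V\<rbrakk> \<Longrightarrow> T h k x = T k h x"
    and swap23: "\<And>h k x. \<lbrakk>h \<in> V; k \<in> V; x \<in> V\<rbrakk> \<Longrightarrow> T h k x = T h x k"
begin

lemma add2: "\<lbrakk>h \<in> V; k \<in> V; x \<in> V; y \<in> V\<rbrakk> \<Longrightarrow> T x (h + k) y = T x h y + T x k y"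
  using add1[of h k x y] swap12[of x "h + k" y] swap12[of x h y] swap12[of x k y] subgrp_add[OF V]
  by simp

lemma subgrp_tker:
  assumes U: "subgrp U" "U \<subseteq> V" and h: "h \<in> V"
  shows "subgrp (tker T U h)"
proof -
  have "T h (0 + 0) y = T h 0 y + T h 0 y" if "y \<in> U" for y
    using that U h by (intro add2) (auto simp: subgrp_def)
  then have "0 \<in> tker T U h" using U by (auto simp: tker_def subgrp_0)
  moreover have "x + x' \<in> tker T U h" if "x \<in> tker T U h" "x' \<in> tker T U h" for x x'
  proof -
    have "T h (x + x') y = 0" if "y \<in> U" for y
      using add2[of x x' h y] \<open>x \<in> tker T U h\<close> \<open>x' \<in> tker T U h\<close> that U h
      by (auto simp: tker_def subset_iff)
    then show ?thesis using that U(1) by (auto simp: tker_def subgrp_add)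
  qed
  ultimately show ?thesis using U(1) by (auto simp: subgrp_def tker_def)
qed

text \<open>Choose \<open>h\<^sub>0\<close> of maximal rank on \<open>U\<close> and let \<open>W\<close> be its kernel. If some \<open>T h\<close> kept its full
  rank on \<open>W\<close>, then \<open>W + ker T h = U\<close>, so the ranks of \<open>T h\<^sub>0\<close> and \<open>T h\<close> would add up
  in \<open>T (h\<^sub>0 + h)\<close>, contradicting maximality.\<close>

lemma rank_reduction:
  assumes S: "subgrp S" "S \<subseteq> V" and U: "subgrp U" "U \<subseteq> V"
    and rank: "\<And>h. h \<in> S \<Longrightarrow> card U \<le> 2 ^ s * card (tker T U h)"
  shows "\<exists>U'. subgrp U' \<and> U' \<subseteq> U \<and> card U \<le> 2 ^ (s * s) * card U' \<and>
              (\<forall>h\<in>S. \<forall>x\<in>U'. \<forall>y\<in>U'. T h x y = 0)"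
  using U rank
proof (induction s arbitrary: U)
  case 0
  have "tker T U h = U" if "h \<in> S" for h
  proof (rule card_subset_eq)
    show "finite U" "tker T U h \<subseteq> U" using 0 by (auto simp: tker_def subgrp_def)
    then show "card (tker T U h) = card U"
      using 0(3)[OF that] card_mono[of U "tker T U h"] by simp
  qed
  then have "T h x y = 0" if "h \<in> S" "x \<in> U" "y \<in> U" for h x y
  proof -
    have "x \<in> tker T U h" using \<open>\<And>h. h \<in> S \<Longrightarrow> tker T U h = U\<close> that by simp
    then show ?thesis using that by (simp add: tker_def)
  qed
  then show ?case using 0(1) by (intro exI[of _ U]) simp
next
  case (Suc s)
  note U = Suc.prems(1,2) and rank = Suc.prems(3)
  show ?case
  proof (cases "\<forall>h\<in>S. card U \<le> 2 ^ s * card (tker T U h)")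
    case True
    then obtain U' where U': "subgrp U'" "U' \<subseteq> U" "card U \<le> 2 ^ (s * s) * card U'"
        "\<forall>h\<in>S. \<forall>x\<in>U'. \<forall>y\<in>U'. T h x y = 0"
      using Suc.IH[OF U] by blast
    note U'(3)
    also have "2 ^ (s * s) * card U' \<le> 2 ^ (Suc s * Suc s) * card U'"
      by (intro mult_le_mono1 power_increasing) auto
    finally show ?thesis using U' by blast
  next
    case False
    then obtain h0 where h0: "h0 \<in> S" "2 ^ s * card (tker T U h0) < card U"
      by (auto simp: not_le)
    define W where "W = tker T U h0"
    have W: "subgrp W" "W \<subseteq> U" using subgrp_tker[OF U] h0 S by (auto simp: W_def tker_def)
    obtain r where r: "card U = 2 ^ r * card W" using card_subgrp_pow2[OF U(1) W] by auto
    \<comment> \<open>The hypothesis bounds the rank of \<open>h0\<close> by s + 1, and the choice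
      of \<open>h0\<close> makes it exceed s.\<close>
    have "r = Suc s"
    proof -
      have "2 ^ r * card W \<le> 2 ^ Suc s * card W" using rank[OF h0(1)] r W_def by simp
      moreover have "2 ^ s * card W < 2 ^ r * card W" using h0 r W_def by simp
      ultimately have *: "(2::nat) ^ r \<le> 2 ^ Suc s" "(2::nat) ^ s < 2 ^ r"
        using subgrp_card_pos[OF W(1)] by (simp_all only: mult_le_cancel2 mult_less_cancel2)
      have "r \<le> Suc s" by (rule power_le_imp_le_exp[OF _ *(1)]) simp
      moreover have "s < r" by (rule power_less_imp_less_exp[OF _ *(2)]) simp
      ultimately show ?thesis by simp
    qed
    have step: "card W \<le> 2 ^ s * card (tker T W h)" if h: "h \<in> S" for h
    proof (rule ccontr)
      assume neg: "\<not> ?thesis"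
      have WV: "W \<subseteq> V" and hV: "h \<in> V" "h0 \<in> V" and hh: "h0 + h \<in> S"
        using W U S h h0 by (auto simp: subgrp_add)
      let ?K = "tker T U h"
      have K: "subgrp ?K" "?K \<subseteq> U" using subgrp_tker[OF U hV(1)] by (auto simp: tker_def)
      let ?L = "tker T W h"
      have L: "subgrp ?L" "?L \<subseteq> W" using subgrp_tker[OF W(1) WV hV(1)] by (auto simp: tker_def)
      have KL: "W \<inter> ?K \<subseteq> ?L" using W by (auto simp: tker_def)
      have cKL: "card (W \<inter> ?K) \<le> card ?L" using KL L by (intro card_mono) (auto simp: subgrp_def)
      let ?Q = "{w + k |w k. w \<in> W \<and> k \<in> ?K}"
      have Q: "subgrp ?Q" "?Q \<subseteq> U" using subgrp_sumset[OF W(1) K(1)] W K U by (auto intro: subgrp_add)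
      obtain q where q: "card U = 2 ^ q * card ?Q" using card_subgrp_pow2[OF U(1) Q] by auto
      \<comment> \<open>If W + K had index at least 2 in U, then the product formula and the
        smallness of the radical of \<open>T h\<close> on W would push the rank of h on U above s +
        1.\<close>
      have "q = 0"
      proof (rule ccontr)
        assume "q \<noteq> 0"
        then have "2 * card ?Q \<le> card U" unfolding q by (cases q) auto
        moreover have "2 ^ s * (card W * card ?K) \<le> card ?Q * (2 ^ s * card ?L)"
          using mult_le_mono2[OF order_trans[OF card_sumset_Int[OF W(1) K(1)] mult_le_mono2[OF cKL]], of "2 ^ s"]
          by (simp add: mult_ac)
        moreover have "card ?Q * (2 ^ s * card ?L) < card ?Q * card W"
          using neg subgrp_card_pos[OF Q(1)] by simp
        ultimately have "2 ^ s * (card W * card ?K) < card ?Q * card W" by linarith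
        then have "2 ^ s * card ?K < card ?Q" by (simp add: mult.commute mult.left_commute)
        then have "2 ^ Suc s * card ?K < card U" using \<open>2 * card ?Q \<le> card U\<close> by simp
        then show False using rank[OF h] by simp
      qed
      then have QU: "?Q = U"
        using Q U q by (intro card_subset_eq) (auto simp: subgrp_def)
      \<comment> \<open>For x = w + z in the left side, the forms \<open>T h0 z\<close> and
        \<open>T h w\<close> agree on U. By symmetry the first vanishes on W and the second on K, so
        both vanish on W + K = U. Hence w also lies in K and z also lies in W.\<close>
      have "tker T U (h0 + h) \<subseteq> W \<inter> ?K"
      proof
        fix x assume x: "x \<in> tker T U (h0 + h)"
        then have xU: "x \<in> U" by (simp add: tker_def)
        then obtain w z where wz: "w \<in> W" "z \<in> ?K" "x = w + z" using QU by blast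
        have inV: "w \<in> V" "z \<in> V" "w \<in> U" "z \<in> U" using wz W K U by auto
        have eq: "T h0 z y = T h w y" if y: "y \<in> U" for y
        proof -
          have yV: "y \<in> V" using y U by auto
          have "0 = T (h0 + h) (w + z) y" using x y wz by (auto simp: tker_def)
          also have "\<dots> = (T h0 w y + T h0 z y) + (T h w y + T h z y)"
            using add1[of h0 h "w + z" y] add2[of w z _ y] inV yV hV subgrp_add[OF V] by simp
          also have "T h0 w y = 0" using wz(1) y by (simp add: W_def tker_def)
          also have "T h z y = 0" using wz(2) y by (simp add: tker_def)
          finally have "T h0 z y + T h w y = 0" by simp
          then show ?thesis by simp
        qed
        have wW: "T h w y = 0" if y: "y \<in> W" for y
        proof -
          have "T h0 z y = T h0 y z" using y WV inV hV by (intro swap23) auto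
          also have "\<dots> = 0" using y inV by (simp add: W_def tker_def)
          finally show ?thesis using eq[of y] y W by auto
        qed
        have wK: "T h w y = 0" if y: "y \<in> ?K" for y
        proof -
          have "T h w y = T h y w" using y K U inV hV by (intro swap23) auto
          also have "\<dots> = 0" using y inV by (simp add: tker_def)
          finally show ?thesis .
        qed
        have w0: "T h w y = 0" if "y \<in> U" for y
        proof -
          obtain a b where ab: "a \<in> W" "b \<in> ?K" "y = a + b" using \<open>y \<in> U\<close> QU by blast
          have abV: "a \<in> V" "b \<in> V" using ab WV K U by auto
          have "T h w y = T h y w" using abV ab inV hV V by (intro swap23) (auto simp: subgrp_add)
          also have "\<dots> = T h a w + T h b w" unfolding ab by (intro add2) (use abV inV hV in auto)
          also have "\<dots> = T h w a + T h w b"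
            using swap23[of h a w] swap23[of h b w] abV inV hV by simp
          also have "\<dots> = 0" using wW[OF ab(1)] wK[OF ab(2)] by simp
          finally show ?thesis .
        qed
        have "w \<in> ?K" using w0 inV by (simp add: tker_def)
        moreover have "z \<in> W" using w0 eq inV by (simp add: W_def tker_def)
        ultimately show "x \<in> W \<inter> ?K" using wz W(1) K(1) by (auto simp: subgrp_add)
      qed
      \<comment> \<open>The rank of \<open>h0 + h\<close> is at most s + 1, which is exactly the
        codimension of W; so the radical on W is all of W, against the assumption that it is
        small.\<close>
      then have "card (tker T U (h0 + h)) \<le> card ?L"
        using KL L by (intro card_mono) (auto simp: subgrp_def)
      then have "card U \<le> 2 ^ Suc s * card ?L"
        using rank[OF hh] by (meson le_trans mult_le_mono2)
      then have "card W \<le> card ?L" unfolding r \<open>r = Suc s\<close> by simp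
      also have "\<dots> \<le> 2 ^ s * card ?L" by simp
      finally show False using neg by simp
    qed
    obtain U' where U': "subgrp U'" "U' \<subseteq> W" "card W \<le> 2 ^ (s * s) * card U'"
        "\<forall>h\<in>S. \<forall>x\<in>U'. \<forall>y\<in>U'. T h x y = 0"
      using Suc.IH[OF W(1) subset_trans[OF W(2) U(2)] step] by blast
    \<comment> \<open>Codimension s + 1 is spent on W and s * s by induction, within the allowance
      (s + 1) * (s + 1).\<close>
    have "card U \<le> 2 ^ (Suc s + s * s) * card U'"
      using mult_le_mono2[OF U'(3), of "2 ^ Suc s"] r \<open>r = Suc s\<close> by (simp add: power_add mult_ac)
    also have "\<dots> \<le> 2 ^ (Suc s * Suc s) * card U'"
      by (intro mult_le_mono1 power_increasing) auto
    finally show ?thesis using U' W by blast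
  qed
qed

section \<open>Directions of small rank\<close>

definition low_rank :: "nat \<Rightarrow> 'v set" where
  "low_rank s = {h\<in>V. card V \<le> 2 ^ s * card (tker T V h)}"

text \<open>Rank is subadditive: the radical for h + k contains the intersection of the radicals for
  h and k.\<close>

lemma low_rank_add:
  assumes "h \<in> low_rank s" "k \<in> low_rank s"
  shows "h + k \<in> low_rank (2 * s)"
proof -
  have hk: "h \<in> V" "k \<in> V" using assms by (auto simp: low_rank_def)
  let ?H = "tker T V h" and ?K = "tker T V k"
  have sub: "subgrp ?H" "subgrp ?K" "?H \<subseteq> V" "?K \<subseteq> V"
    using subgrp_tker[OF V order_refl] hk by (auto simp: tker_def)
  have "card V * card V \<le> (2 ^ s * card ?H) * (2 ^ s * card ?K)"
    using assms by (intro mult_le_mono) (auto simp: low_rank_def)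
  also have "\<dots> = 2 ^ (2 * s) * (card ?H * card ?K)" by (simp add: power_add mult_2)
  also have "\<dots> \<le> 2 ^ (2 * s) * (card V * card (?H \<inter> ?K))"
    by (intro mult_le_mono2 card_Int_subgrp V sub)
  finally have "card V * card V \<le> card V * (2 ^ (2 * s) * card (?H \<inter> ?K))" by (simp add: mult_ac)
  then have "card V \<le> 2 ^ (2 * s) * card (?H \<inter> ?K)" using subgrp_card_pos[OF V] by simp
  also have "\<dots> \<le> 2 ^ (2 * s) * card (tker T V (h + k))"
  proof (intro mult_le_mono2 card_mono)
    show "finite (tker T V (h + k))" using V by (simp add: tker_def subgrp_def)
    show "?H \<inter> ?K \<subseteq> tker T V (h + k)" using add1 hk by (auto simp: tker_def)
  qed
  finally show ?thesis using hk V by (simp add: low_rank_def subgrp_add)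
qed

lemma low_rank_mono: "s \<le> t \<Longrightarrow> low_rank s \<subseteq> low_rank t"
proof
  fix h assume "s \<le> t" "h \<in> low_rank s"
  moreover have "2 ^ s * card (tker T V h) \<le> 2 ^ t * card (tker T V h)"
    using \<open>s \<le> t\<close> by (intro mult_le_mono1 power_increasing) auto
  ultimately show "h \<in> low_rank t" unfolding low_rank_def by (auto intro: order_trans)
qed

lemma zero_low_rank: "0 \<in> low_rank s"
proof -
  have "T (0 + 0) x y = T 0 x y + T 0 x y" if "x \<in> V" "y \<in> V" for x y
    using that V by (intro add1) (auto simp: subgrp_0)
  then have "tker T V 0 = V" by (auto simp: tker_def)
  then show ?thesis using V by (simp add: low_rank_def subgrp_0)
qed

text \<open>The sets \<^term>\<open>low_rank (2 ^ i * s)\<close> increase inside \<^term>\<open>V\<close>, so at some scale the growth is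
  below 3/2, where the sumset is a subgroup.\<close>

lemma low_rank_subgrp:
  assumes dense: "card V \<le> K * card (low_rank s)" and K: "K * 2 ^ n < 3 ^ n"
  shows "\<exists>S. subgrp S \<and> S \<subseteq> low_rank (2 ^ n * s) \<and> card V \<le> K * card S"
proof -
  define a where "a i = card (low_rank (2 ^ i * s))" for i
  have fin: "finite (low_rank t)" for t using V by (simp add: low_rank_def subgrp_def)
  have "\<exists>i<n. 2 * a (Suc i) < 3 * a i"
  proof (rule ccontr)
    assume "\<not> ?thesis"
    then have grow: "3 * a i \<le> 2 * a (Suc i)" if "i < n" for i using that by (meson not_le)
    \<comment> \<open>Growth by 3/2 at each of n scales would exceed the room K left by the density
      hypothesis.\<close>
    have "3 ^ i * a 0 \<le> 2 ^ i * a i" if "i \<le> n" for i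
      using that
    proof (induction i)
      case (Suc i)
      have "3 ^ Suc i * a 0 = 3 * (3 ^ i * a 0)" by simp
      also have "\<dots> \<le> 2 ^ i * (3 * a i)" using Suc by simp
      also have "\<dots> \<le> 2 ^ i * (2 * a (Suc i))" using grow[of i] Suc.prems by (intro mult_le_mono2) auto
      finally show ?case by simp
    qed simp
    then have "3 ^ n * a 0 \<le> 2 ^ n * a n" by simp
    also have "a n \<le> card V" unfolding a_def
      using V by (intro card_mono) (auto simp: low_rank_def subgrp_def)
    also have "card V \<le> K * a 0" using dense by (simp add: a_def)
    finally have "3 ^ n * a 0 \<le> (K * 2 ^ n) * a 0" by (simp add: mult_ac)
    moreover have "a 0 > 0" unfolding a_def using fin zero_low_rank by (auto simp: card_gt_0_iff)
    ultimately show False using K by simp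
  qed
  then obtain i where i: "i < n" "2 * a (Suc i) < 3 * a i" by blast
  let ?B = "low_rank (2 ^ i * s)"
  let ?S = "{b + c |b c. b \<in> ?B \<and> c \<in> ?B}"
  have S_sub: "?S \<subseteq> low_rank (2 ^ Suc i * s)"
    using low_rank_add[of _ "2 ^ i * s"] by (auto simp: mult.assoc)
  have "card ?S \<le> a (Suc i)" unfolding a_def by (intro card_mono fin S_sub)
  then have "subgrp ?S"
    using i zero_low_rank by (intro subgrp_small_doubling[OF fin _ refl]) (auto simp: a_def)
  moreover have "low_rank (2 ^ Suc i * s) \<subseteq> low_rank (2 ^ n * s)"
    using i by (intro low_rank_mono mult_le_mono1 power_increasing) auto
  moreover have "low_rank s \<subseteq> ?S"
  proof
    fix h assume "h \<in> low_rank s"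
    then have "h \<in> ?B" using low_rank_mono[of s "2 ^ i * s"] by auto
    then show "h \<in> ?S" using zero_low_rank by (intro CollectI exI[of _ h] exI[of _ 0]) simp
  qed
  then have "card (low_rank s) \<le> card ?S"
    using finite_subset[OF S_sub fin] by (intro card_mono)
  then have "card V \<le> K * card ?S" using dense by (meson le_trans mult_le_mono2)
  ultimately show ?thesis using S_sub by blast
qed

text \<open>First find a dense subgroup S of directions of small rank, then a large U on which all
  their forms vanish. Intersecting S with U puts all three arguments into one subgroup.\<close>

lemma vanishing_subgrp:
  assumes dense: "card V \<le> K * card (low_rank s)" and K: "K * 2 ^ n < 3 ^ n"
  shows "\<exists>U. subgrp U \<and> U \<subseteq> V \<and> card V \<le> K * 2 ^ ((2 ^ n * s) * (2 ^ n * s)) * card U \<and>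
             (\<forall>h\<in>U. \<forall>x\<in>U. \<forall>y\<in>U. T h x y = 0)"
proof -
  obtain S where S: "subgrp S" "S \<subseteq> low_rank (2 ^ n * s)" "card V \<le> K * card S"
    using low_rank_subgrp[OF assms] by blast
  have SV: "S \<subseteq> V" using S(2) by (auto simp: low_rank_def)
  let ?c = "2 ^ ((2 ^ n * s) * (2 ^ n * s)) :: nat"
  have "\<exists>U. subgrp U \<and> U \<subseteq> V \<and> card V \<le> ?c * card U \<and> (\<forall>h\<in>S. \<forall>x\<in>U. \<forall>y\<in>U. T h x y = 0)"
    by (rule rank_reduction[OF S(1) SV V order_refl]) (use S(2) in \<open>auto simp: low_rank_def\<close>)
  then obtain U where U: "subgrp U" "U \<subseteq> V" "card V \<le> ?c * card U" "\<forall>h\<in>S. \<forall>x\<in>U. \<forall>y\<in>U. T h x y = 0"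
    by blast
  have "card V * card V \<le> (K * card S) * (?c * card U)" by (intro mult_le_mono S U)
  also have "\<dots> = (K * ?c) * (card S * card U)" by (simp only: mult_ac)
  also have "\<dots> \<le> (K * ?c) * (card V * card (S \<inter> U))"
    by (intro mult_le_mono2 card_Int_subgrp V S U SV)
  finally have "card V * card V \<le> card V * (K * ?c * card (S \<inter> U))" by (simp only: mult_ac)
  then have "card V \<le> K * ?c * card (S \<inter> U)"
    using subgrp_card_pos[OF V] by (simp only: mult_le_cancel1)
  then show ?thesis using U S by (intro exI[of _ "S \<inter> U"]) (auto simp: subgrp_Int)
qed

end

section \<open>The values of biases of cubics\<close>

text \<open>Level 0 contains the biases of quadratics. Level r contains the biases on V of functions
  that are quadratic on the cosets of a subgroup of index 2^r: each doubling averages two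
  values.\<close>

fun dyad :: "nat \<Rightarrow> real set" where
  "dyad 0 = insert 0 (range (\<lambda>j::nat. (1/2)^j) \<union> range (\<lambda>j::nat. -((1/2)^j)))"
| "dyad (Suc r) = (\<lambda>x. x / 2) ` {x + y |x y. x \<in> dyad r \<and> y \<in> dyad r}"

text \<open>Level 0 is a union of two sequences converging to 0 with their limit; halved sums of
  compact sets are compact. Compactness turns the absence of 1/3 into a positive distance.\<close>

lemma compact_dyad: "compact (dyad r)"
proof (induction r)
  case 0
  have 1: "(\<lambda>j::nat. (1/2::real)^j) \<longlonglongrightarrow> 0" by (rule LIMSEQ_power_zero) simp
  have 2: "(\<lambda>j::nat. -((1/2::real)^j)) \<longlonglongrightarrow> 0" using tendsto_minus[OF 1] by simp
  have "compact (insert 0 (range (\<lambda>j::nat. (1/2::real)^j)) \<union> insert 0 (range (\<lambda>j::nat. -((1/2::real)^j))))"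
    by (intro compact_Un compact_sequence_with_limit 1 2)
  also have "\<dots> = dyad 0" unfolding dyad.simps by blast
  finally show ?case .
next
  case (Suc r)
  have "compact ((\<lambda>x. x / 2) ` {x + y |x y. x \<in> dyad r \<and> y \<in> dyad r})"
    by (intro compact_continuous_image compact_sums Suc continuous_intros) auto
  then show ?case by simp
qed

lemma dyad_rational: "x \<in> dyad r \<Longrightarrow> \<exists>(z::int) k::nat. x * 2 ^ k = of_int z"
proof (induction r arbitrary: x)
  case 0
  then consider "x = 0" | j :: nat where "x = (1/2)^j" | j :: nat where "x = -((1/2)^j)" by auto
  then show ?case
  proof cases
    case 1
    then show ?thesis by (intro exI[of _ 0]) simp
  next
    case (2 j)
    then show ?thesis by (intro exI[of _ 1] exI[of _ j]) (simp add: power_divide)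
  next
    case (3 j)
    then show ?thesis by (intro exI[of _ "-1"] exI[of _ j]) (simp add: power_divide)
  qed
next
  case (Suc r)
  then obtain y z where yz: "y \<in> dyad r" "z \<in> dyad r" "x = (y + z) / 2" by auto
  obtain a k where a: "y * 2 ^ k = of_int a" using Suc.IH[OF yz(1)] by blast
  obtain b l where b: "z * 2 ^ l = of_int b" using Suc.IH[OF yz(2)] by blast
  have "x * 2 ^ (Suc (k + l)) = (y * 2 ^ k) * 2 ^ l + (z * 2 ^ l) * 2 ^ k"
    unfolding yz(3) by (simp add: power_add algebra_simps)
  also have "\<dots> = of_int (a * 2 ^ l + b * 2 ^ k)" unfolding a b by simp
  finally show ?case by blast
qed

lemma third_notin_dyad: "1/3 \<notin> dyad r"
proof
  assume "1/3 \<in> dyad r"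
  then obtain z :: int and k :: nat where "1/3 * 2 ^ k = (of_int z :: real)" using dyad_rational by blast
  then have "of_int (2 ^ k) = (of_int (3 * z) :: real)" by (simp add: field_simps)
  then have "2 ^ k = 3 * z" by (simp only: of_int_eq_iff)
  then have "3 dvd (2::int) ^ k" by simp
  moreover have "prime (3::int)" by simp
  ultimately have "3 dvd (2::int)" by (rule prime_dvd_power[rotated])
  then show False by simp
qed

lemma dyad_mono: "r \<le> s \<Longrightarrow> dyad r \<subseteq> dyad s"
proof (rule lift_Suc_mono_le[of dyad])
  show "dyad n \<le> dyad (Suc n)" for n
  proof
    fix x assume "x \<in> dyad n"
    then have "x + x \<in> {x + y |x y. x \<in> dyad n \<and> y \<in> dyad n}" by blast
    then show "x \<in> dyad (Suc n)" by (auto intro!: rev_image_eqI)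
  qed
qed

text \<open>Doubling W expresses a bias as the average of the biases on two cosets of W, so the
  induction has to treat all translates of f at once.\<close>

lemma bias_in_dyad:
  assumes V: "subgrp V" and U: "subgrp U" "U \<subseteq> V"
    and quad: "\<And>a. a \<in> V \<Longrightarrow> deg_le 2 U (\<lambda>x. f (a + x))"
  shows "\<exists>r. card V = 2 ^ r * card U \<and> bias V f \<in> dyad r"
proof -
  \<comment> \<open>A copy of V: the translations range over the full group while the induction
    replaces V by intermediate subgroups.\<close>
  define A where "A = V"
  have "\<exists>r. card V = 2 ^ r * card U \<and> (\<forall>a\<in>A. bias V (\<lambda>x. f (a + x)) \<in> dyad r)"
    using V U
  proof (induction rule: subgrp_double_induct)
    case base
    have "bias U (\<lambda>x. f (a + x)) \<in> dyad 0" if "a \<in> A" for a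
      using bias_deg_2[OF U(1) quad[of a]] that A_def by simp
    then show ?case by (intro exI[of _ 0]) simp
  next
    case (double W v)
    then obtain r where r: "card W = 2 ^ r * card U" "\<forall>a\<in>A. bias W (\<lambda>x. f (a + x)) \<in> dyad r" by blast
    have "bias (W \<union> (+) v ` W) (\<lambda>x. f (a + x)) \<in> dyad (Suc r)" if "a \<in> A" for a
    proof -
      have "bias W (\<lambda>x. f ((a + v) + x)) \<in> dyad r"
        using r(2) that double V A_def by (simp add: subgrp_add)
      then have "bias W (\<lambda>x. f (a + (v + x))) \<in> dyad r" by (simp add: add.assoc)
      moreover have "bias W (\<lambda>x. f (a + x)) \<in> dyad r" using r(2) that by blast
      ultimately show ?thesis
        unfolding bias_double[OF double(1,5)] dyad.simps by blast
    qed
    then show ?case using r(1) subgrp_double(3)[OF double(1,5)] by (intro exI[of _ "Suc r"]) simp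
  qed
  then obtain r where "card V = 2 ^ r * card U" "\<forall>a\<in>A. bias V (\<lambda>x. f (a + x)) \<in> dyad r" by blast
  moreover have "0 \<in> A" using subgrp_0[OF V] by (simp add: A_def)
  ultimately have "card V = 2 ^ r * card U" "bias V (\<lambda>x. f (0 + x)) \<in> dyad r" by blast+
  then show ?thesis by auto
qed

section \<open>The third derivative of a cubic as a trilinear form\<close>

definition trider :: "('v::char2_group \<Rightarrow> bit) \<Rightarrow> 'v \<Rightarrow> 'v \<Rightarrow> 'v \<Rightarrow> bit" where
  "trider f h k l = diff h (diff k (diff l f)) 0"

lemma trider_const:
  assumes "subgrp V" "deg_le 3 V f" "h \<in> V" "k \<in> V" "l \<in> V" "x \<in> V"
  shows "diff h (diff k (diff l f)) x = trider f h k l"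
  unfolding trider_def
  by (rule deg_le_0_D[OF assms(1)]) (use assms in \<open>simp_all add: numeral_3_eq_3 del: deg_le.simps(1)\<close>)

text \<open>Symmetry holds because derivatives commute. Additivity is the cocycle rule; its shifted
  base point is harmless because third derivatives of a cubic are constant.\<close>

lemma trider_symmetric_trilinear:
  assumes V: "subgrp V" and f: "deg_le 3 V f"
  shows "symmetric_trilinear V (trider f)"
proof
  show "subgrp V" by fact
  show "trider f (h + k) x y = trider f h x y + trider f k x y"
    if "h \<in> V" "k \<in> V" "x \<in> V" "y \<in> V" for h k x y
  proof -
    have "trider f (h + k) x y = diff h (diff x (diff y f)) (0 + k) + trider f k x y"
      unfolding trider_def by (rule diff_add)
    also have "diff h (diff x (diff y f)) (0 + k) = trider f h x y"
      using that by (intro trider_const[OF V f]) (auto simp: subgrp_0)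
    finally show ?thesis .
  qed
qed (simp_all only: trider_def diff_commute)

text \<open>The link between rank and bias: the radical of the form at h is the radical of the
  quadratic \<open>diff h f\<close>, whose index controls the bias of that quadratic.\<close>

lemma tker_trider:
  assumes V: "subgrp V" and f: "deg_le 3 V f" and h: "h \<in> V"
  shows "tker (trider f) V h = dker V (diff h f)"
proof -
  interpret symmetric_trilinear V "trider f" by (rule trider_symmetric_trilinear[OF V f])
  have "deg_le 0 V (diff k (diff h f)) \<longleftrightarrow> (\<forall>l\<in>V. trider f h k l = 0)" if k: "k \<in> V" for k
  proof -
    let ?g = "diff k (diff h f)"
    have eq: "trider f h k l = ?g l + ?g 0" if "l \<in> V" for l
    proof -
      have "trider f h k l = trider f l k h"
        using swap12 swap23 h k that by metis
      then show ?thesis by (simp add: trider_def diff_def[of l])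
    qed
    show ?thesis
    proof
      assume "deg_le 0 V ?g"
      then have "?g l = ?g 0" if "l \<in> V" for l using that by (rule deg_le_0_D[OF V])
      then show "\<forall>l\<in>V. trider f h k l = 0" by (intro ballI) (simp only: eq add_self)
    next
      assume "\<forall>l\<in>V. trider f h k l = 0"
      then show "deg_le 0 V ?g" by (intro deg_le_0_I) (simp add: eq)
    qed
  qed
  then show ?thesis by (auto simp: tker_def dker_def simp del: deg_le.simps)
qed

text \<open>The derivatives have mean bias at least 1/16, so at least 1/32 of the directions have
  bias at least 1/32. For these the radical has density at least 1/1024 = 2^-10, which is where the
  10 comes from.\<close>

lemma low_rank_dense:
  assumes V: "subgrp V" and f: "deg_le 3 V f" and b: "bias V f \<ge> 1/4"
  shows "card V \<le> 32 * card (symmetric_trilinear.low_rank V (trider f) 10)"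
proof -
  interpret symmetric_trilinear V "trider f" by (rule trider_symmetric_trilinear[OF V f])
  let ?A = "{h\<in>V. bias V (diff h f) \<ge> 1/32}"
  have fin: "finite V" using V by (rule subgrp_finite)
  have "?A \<subseteq> low_rank 10"
  proof
    fix h assume "h \<in> ?A"
    then have h: "h \<in> V" "bias V (diff h f) \<ge> 1/32" by auto
    have "deg_le 2 V (diff h f)" using f h by (simp add: numeral_3_eq_3 numeral_2_eq_2)
    moreover have sq: "(bias V (diff h f))\<^sup>2 \<ge> (1/32)\<^sup>2" using h(2) by (intro power_mono) auto
    ultimately have "(bias V (diff h f))\<^sup>2 = real (card (dker V (diff h f))) / real (card V)"
      using bias_square_deg_2[OF V] by (fastforce simp: power2_eq_square)
    then have "(1/32)\<^sup>2 \<le> real (card (dker V (diff h f))) / real (card V)" using sq by simp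
    then have "real (card V) \<le> 1024 * real (card (dker V (diff h f)))"
      using subgrp_card_pos[OF V] by (simp add: field_simps power2_eq_square)
    then have "card V \<le> 1024 * card (tker (trider f) V h)"
      unfolding tker_trider[OF V f h(1)] by linarith
    then show "h \<in> low_rank 10" using h by (simp add: low_rank_def)
  qed
  then have "card ?A \<le> card (low_rank 10)"
    using fin by (intro card_mono) (auto simp: low_rank_def)
  moreover have "real (card V) \<le> 32 * real (card ?A)"
  proof -
    have "(1/4)\<^sup>2 \<le> (bias V f)\<^sup>2" using b by (intro power_mono) auto
    then have "real (card V) / 16 \<le> (\<Sum>h\<in>V. bias V (diff h f))"
      unfolding bias_square[OF V] using subgrp_card_pos[OF V] by (simp add: field_simps power2_eq_square)
    also have "\<dots> \<le> (\<Sum>h\<in>V. (if h \<in> ?A then 1 else 0) + 1/32)"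
    proof (rule sum_mono)
      fix h assume "h \<in> V"
      then show "bias V (diff h f) \<le> (if h \<in> ?A then 1 else 0) + 1/32"
        using abs_bias_le_1[OF V, of "diff h f"] by auto
    qed
    also have "\<dots> = real (card ?A) + real (card V) / 32"
      using fin by (simp add: sum.distrib flip: sum.inter_filter)
    finally show ?thesis by simp
  qed
  ultimately show ?thesis by linarith
qed

lemma cubic_structure:
  obtains M :: nat where
    "\<And>(V :: 'v::char2_group set) f. subgrp V \<Longrightarrow> deg_le 3 V f \<Longrightarrow> bias V f \<ge> 1/4 \<Longrightarrow>
       \<exists>U. subgrp U \<and> U \<subseteq> V \<and> card V \<le> 2 ^ M * card U \<and> (\<forall>a\<in>V. deg_le 2 U (\<lambda>x. f (a + x)))"
proof -
  \<comment> \<open>The 9 is the least n with 32 * 2^n < 3^n, and 10 is the rank bound of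
    \<open>low_rank_dense\<close>. The extra 5 in the final exponent accounts for the density
    1/32.\<close>
  define t :: nat where "t = 2 ^ 9 * 10"
  have "\<exists>U. subgrp U \<and> U \<subseteq> V \<and> card V \<le> 2 ^ (5 + t * t) * card U \<and> (\<forall>a\<in>V. deg_le 2 U (\<lambda>x. f (a + x)))"
    if V: "subgrp V" and f: "deg_le 3 V f" and b: "bias V f \<ge> 1/4" for V :: "'v set" and f
  proof -
    interpret symmetric_trilinear V "trider f" by (rule trider_symmetric_trilinear[OF V f])
    have "\<exists>U. subgrp U \<and> U \<subseteq> V \<and> card V \<le> 32 * 2 ^ (t * t) * card U \<and>
              (\<forall>h\<in>U. \<forall>x\<in>U. \<forall>y\<in>U. trider f h x y = 0)"
      unfolding t_def by (rule vanishing_subgrp[OF low_rank_dense[OF V f b]]) simp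
    then obtain U where U: "subgrp U" "U \<subseteq> V" "card V \<le> 32 * 2 ^ (t * t) * card U"
        and zero: "\<forall>h\<in>U. \<forall>x\<in>U. \<forall>y\<in>U. trider f h x y = 0"
      by blast
    have "deg_le 2 U (\<lambda>x. f (a + x))" if a: "a \<in> V" for a
    proof -
      let ?g = "\<lambda>x. f (a + x)"
      have "deg_le 0 U (diff h (diff k ?g))" if hk: "h \<in> U" "k \<in> U" for h k
      proof (rule deg_le_0_I)
        fix l assume l: "l \<in> U"
        \<comment> \<open>A third derivative of the translate is the constant value of the form,
          which is 0 on U; so second derivatives are constant on U.\<close>
        have "diff l (diff h (diff k ?g)) 0 = diff l (diff h (diff k f)) (a + 0)"
          by (simp only: diff_translate)
        also have "\<dots> = 0"
          using trider_const[OF V f, of l h k "a + 0"] zero l hk a U(2) by auto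
        finally show "diff h (diff k ?g) l = diff h (diff k ?g) 0"
          unfolding diff_def[of l] by simp
      qed
      then show ?thesis by (simp add: numeral_2_eq_2 del: deg_le.simps(1))
    qed
    then show ?thesis using U by (intro exI[of _ U]) (simp add: power_add)
  qed
  then show ?thesis using that by blast
qed

text \<open>M does not depend on V or f, so all biases that are at least 1/4 lie in the single
  closed set \<open>dyad M\<close>, which misses 1/3.\<close>

theorem cubic_bias_gap:
  obtains \<eta> :: real where "\<eta> > 0"
    "\<And>(V :: 'v::char2_group set) f. subgrp V \<Longrightarrow> deg_le 3 V f \<Longrightarrow> \<bar>bias V f - 1/3\<bar> \<ge> \<eta>"
proof -
  obtain M where M: "\<And>(V :: 'v set) f. subgrp V \<Longrightarrow> deg_le 3 V f \<Longrightarrow> bias V f \<ge> 1/4 \<Longrightarrow>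
       \<exists>U. subgrp U \<and> U \<subseteq> V \<and> card V \<le> 2 ^ M * card U \<and> (\<forall>a\<in>V. deg_le 2 U (\<lambda>x. f (a + x)))"
    using cubic_structure by metis
  obtain e where e: "e > 0" "\<And>x. x \<in> dyad M \<Longrightarrow> e \<le> dist (1/3) x"
    using separate_point_closed[OF compact_imp_closed[OF compact_dyad] third_notin_dyad] by metis
  \<comment> \<open>1/12 = 1/3 - 1/4 covers the biases below 1/4.\<close>
  have "\<bar>bias V f - 1/3\<bar> \<ge> min e (1/12)" if V: "subgrp V" and f: "deg_le 3 V f" for V :: "'v set" and f
  proof (cases "bias V f \<ge> 1/4")
    case True
    obtain U where U: "subgrp U" "U \<subseteq> V" "card V \<le> 2 ^ M * card U" "\<forall>a\<in>V. deg_le 2 U (\<lambda>x. f (a + x))"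
      using M[OF V f True] by blast
    obtain r where r: "card V = 2 ^ r * card U" "bias V f \<in> dyad r"
      using bias_in_dyad[OF V U(1,2), of f] U(4) by blast
    have "(2::nat) ^ r \<le> 2 ^ M" using U(3) subgrp_card_pos[OF U(1)] unfolding r(1) by simp
    then have "r \<le> M" by (rule power_le_imp_le_exp[rotated]) simp
    then have "bias V f \<in> dyad M" using r(2) dyad_mono by blast
    then show ?thesis using e(2) by (fastforce simp: dist_real_def)
  next
    case False
    then show ?thesis by linarith
  qed
  then show ?thesis using that[of "min e (1/12)"] e(1) by simp
qed

section \<open>Averages over parallelepipeds\<close>

definition avg :: "'v set \<Rightarrow> ('v \<Rightarrow> real) \<Rightarrow> real" where
  "avg V g = (\<Sum>x\<in>V. g x) / real (card V)"

lemma avg_mono: "(\<And>x. x \<in> V \<Longrightarrow> f x \<le> g x) \<Longrightarrow> avg V f \<le> avg V g"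
  by (simp add: avg_def sum_mono divide_right_mono)

lemma avg_cong: "(\<And>x. x \<in> V \<Longrightarrow> f x = g x) \<Longrightarrow> avg V f = avg V g"
  by (simp add: avg_def)

lemma avg_add: "avg V (\<lambda>x. f x + g x) = avg V f + avg V g"
  by (simp add: avg_def sum.distrib add_divide_distrib)

lemma avg_cmult: "avg V (\<lambda>x. c * f x) = c * avg V f"
  by (simp add: avg_def flip: sum_distrib_left)

lemma avg_cmult_right: "avg V (\<lambda>x. f x * c) = avg V f * c"
  by (simp add: avg_def flip: sum_distrib_right)

lemma avg_const: "subgrp V \<Longrightarrow> avg V (\<lambda>x. c) = c"
  using subgrp_card_pos by (fastforce simp: avg_def)

lemma avg_nonneg: "(\<And>x. x \<in> V \<Longrightarrow> 0 \<le> f x) \<Longrightarrow> 0 \<le> avg V f"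
  by (simp add: avg_def sum_nonneg)

lemma avg_swap: "avg V (\<lambda>x. avg V (\<lambda>y. f x y)) = avg V (\<lambda>y. avg V (\<lambda>x. f x y))"
proof -
  have "(\<Sum>x\<in>V. \<Sum>y\<in>V. f x y) = (\<Sum>y\<in>V. \<Sum>x\<in>V. f x y)" by (rule sum.swap)
  then show ?thesis by (simp add: avg_def flip: sum_divide_distrib)
qed

lemma avg_translate: "subgrp V \<Longrightarrow> a \<in> V \<Longrightarrow> avg V (\<lambda>x. g (x + a)) = avg V g"
  by (simp add: avg_def sum_subgrp_translate)

lemma avg_translate_left: "subgrp V \<Longrightarrow> a \<in> V \<Longrightarrow> avg V (\<lambda>x. g (a + x)) = avg V g"
  using avg_translate[of V a g] by (simp add: add.commute)

lemma avg_square_le: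
  assumes "subgrp V"
  shows "(avg V f)\<^sup>2 \<le> avg V (\<lambda>x. (f x)\<^sup>2)"
proof -
  have "0 \<le> avg V (\<lambda>x. (f x - avg V f)\<^sup>2)" by (intro avg_nonneg) simp
  also have "\<dots> = avg V (\<lambda>x. (f x)\<^sup>2 + ((- 2 * avg V f) * f x + (avg V f)\<^sup>2))"
    by (intro avg_cong) (simp add: power2_eq_square algebra_simps)
  also have "\<dots> = avg V (\<lambda>x. (f x)\<^sup>2) + ((- 2 * avg V f) * avg V f + (avg V f)\<^sup>2)"
    by (simp only: avg_add avg_cmult avg_const[OF assms])
  finally show ?thesis by (simp add: power2_eq_square)
qed

text \<open>The head of the list is averaged innermost. This matches \<open>offs\<close>, where the
  head is the direction along which a smaller box is doubled.\<close>

fun avgl :: "'v set \<Rightarrow> nat \<Rightarrow> ('v list \<Rightarrow> real) \<Rightarrow> real" where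
  "avgl V 0 F = F []"
| "avgl V (Suc d) F = avgl V d (\<lambda>hs. avg V (\<lambda>h. F (h # hs)))"

lemma avgl_mono:
  "(\<And>hs. set hs \<subseteq> V \<Longrightarrow> length hs = d \<Longrightarrow> F hs \<le> G hs) \<Longrightarrow> avgl V d F \<le> avgl V d G"
proof (induction d arbitrary: F G)
  case (Suc d)
  then show ?case unfolding avgl.simps by (intro Suc.IH avg_mono) simp
qed simp

lemma avgl_add: "avgl V d (\<lambda>hs. F hs + G hs) = avgl V d F + avgl V d G"
  by (induction d arbitrary: F G) (simp_all add: avg_add)

lemma avgl_cmult: "avgl V d (\<lambda>hs. c * F hs) = c * avgl V d F"
  by (induction d arbitrary: F) (simp_all add: avg_cmult)

lemma avgl_const: "subgrp V \<Longrightarrow> avgl V d (\<lambda>hs. c) = c"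
  by (induction d) (simp_all add: avg_const)

lemma avgl_square_le:
  assumes "subgrp V"
  shows "(avgl V d F)\<^sup>2 \<le> avgl V d (\<lambda>hs. (F hs)\<^sup>2)"
proof (induction d arbitrary: F)
  case (Suc d)
  have "(avgl V (Suc d) F)\<^sup>2 \<le> avgl V d (\<lambda>hs. (avg V (\<lambda>h. F (h # hs)))\<^sup>2)"
    unfolding avgl.simps by (rule Suc.IH)
  also have "\<dots> \<le> avgl V (Suc d) (\<lambda>hs. (F hs)\<^sup>2)"
    unfolding avgl.simps by (intro avgl_mono avg_square_le assms)
  finally show ?case .
qed simp

text \<open>A list rather than a set: dependent directions produce coinciding vertices, and these
  have to be counted with multiplicity.\<close>

fun offs :: "'v::char2_group list \<Rightarrow> 'v list" where
  "offs [] = [0]"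
| "offs (h # hs) = offs hs @ map ((+) h) (offs hs)"

lemma length_offs: "length (offs hs) = 2 ^ length hs"
  by (induction hs) auto

lemma set_offs: "subgrp V \<Longrightarrow> set hs \<subseteq> V \<Longrightarrow> set (offs hs) \<subseteq> V"
  by (induction hs) (auto simp: subgrp_0 subgrp_add)

text \<open>Even a degenerate box covers the span of its directions uniformly. A new direction
  inside the span only translates it, and one outside doubles it. Thus the bias gap applies to every
  box.\<close>

lemma sum_offs_eq_subgrp:
  assumes V: "subgrp V" and hs: "set hs \<subseteq> V"
  shows "\<exists>H. subgrp H \<and> H \<subseteq> V \<and>
             (\<forall>g :: 'v::char2_group \<Rightarrow> real. sum_list (map g (offs hs)) = 2 ^ length hs * avg H g)"
  using hs
proof (induction hs)
  case Nil
  then show ?case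
    by (intro exI[of _ "{0}"]) (simp add: subgrp_trivial avg_def subgrp_0[OF V])
next
  case (Cons h hs)
  then obtain H where H: "subgrp H" "H \<subseteq> V"
      "\<And>g :: 'v \<Rightarrow> real. sum_list (map g (offs hs)) = 2 ^ length hs * avg H g" by auto
  have sum: "sum_list (map g (offs (h # hs))) = 2 ^ length hs * (avg H g + avg H (\<lambda>x. g (h + x)))"
    for g :: "'v \<Rightarrow> real"
    using H(3)[of g] H(3)[of "\<lambda>x. g (h + x)"] by (simp add: comp_def distrib_left)
  show ?case
  proof (cases "h \<in> H")
    case True
    then show ?thesis
      using H(1,2) by (intro exI[of _ H]) (simp add: sum avg_translate_left del: offs.simps)
  next
    case False
    note d = subgrp_double[OF H(1) False]
    have "avg H g + avg H (\<lambda>x. g (h + x)) = 2 * avg (H \<union> (+) h ` H) g" for g :: "'v \<Rightarrow> real"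
    proof -
      have "(\<Sum>x\<in>H \<union> (+) h ` H. g x) = (\<Sum>x\<in>H. g x) + (\<Sum>x\<in>(+) h ` H. g x)"
        using d(2) H(1) by (intro sum.union_disjoint) (auto simp: subgrp_def)
      also have "(\<Sum>x\<in>(+) h ` H. g x) = (\<Sum>x\<in>H. g (h + x))"
        by (subst sum.reindex) (auto simp: inj_on_def)
      finally show ?thesis using d(3) by (simp add: avg_def add_divide_distrib)
    qed
    moreover have "(+) h ` H \<subseteq> V" using Cons.prems H(2) V by (auto intro!: subgrp_add)
    ultimately show ?thesis
      using H(2) d(1) by (intro exI[of _ "H \<union> (+) h ` H"]) (simp add: sum del: offs.simps)
  qed
qed

definition pts :: "'v::char2_group \<Rightarrow> 'v list \<Rightarrow> 'v list" where
  "pts x hs = map ((+) x) (offs hs)"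

lemma pts_Cons: "pts x (h # hs) = pts x hs @ pts (x + h) hs"
  by (simp add: pts_def add.assoc)

lemma length_pts: "length (pts x hs) = 2 ^ length hs"
  by (simp add: pts_def length_offs)

lemma set_pts: "subgrp V \<Longrightarrow> set hs \<subseteq> V \<Longrightarrow> x \<in> V \<Longrightarrow> set (pts x hs) \<subseteq> V"
  using set_offs[of V hs] by (auto simp: pts_def subgrp_add)

definition wprod :: "('v::char2_group \<Rightarrow> real) \<Rightarrow> 'v \<Rightarrow> 'v list \<Rightarrow> real" where
  "wprod w x hs = prod_list (map w (pts x hs))"

lemma wprod_Cons: "wprod w x (h # hs) = wprod w x hs * wprod w (x + h) hs"
  by (simp add: wprod_def pts_Cons)

lemma prod_list_bounds:
  fixes ps :: "real list"
  assumes "\<And>p. p \<in> set ps \<Longrightarrow> 0 \<le> p \<and> p \<le> 1"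
  shows "0 \<le> prod_list ps \<and> (\<forall>p\<in>set ps. prod_list ps \<le> p) \<and> prod_list ps \<le> 1"
  using assms
proof (induction ps)
  case (Cons a ps)
  then have IH: "0 \<le> prod_list ps" "\<forall>p\<in>set ps. prod_list ps \<le> p" "prod_list ps \<le> 1"
    and a: "0 \<le> a" "a \<le> 1" by auto
  have "a * prod_list ps \<le> a" using a IH mult_left_mono[of "prod_list ps" 1 a] by simp
  moreover have "a * prod_list ps \<le> prod_list ps" using a IH mult_right_mono[of a 1 "prod_list ps"] by simp
  ultimately show ?case using IH a by fastforce
qed simp

text \<open>With the other directions fixed, x and x + h are independent, so averaging over both
  gives a square. Cauchy-Schwarz then takes dimension d to d + 1.\<close>

lemma avg_wprod_ge:
  assumes V: "subgrp V"
  shows "(avg V w) ^ (2 ^ Suc d) \<le> avgl V (Suc d) (\<lambda>hs. avg V (\<lambda>x. wprod w x hs))"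
proof -
  have step: "avgl V (Suc d) (\<lambda>hs. avg V (\<lambda>x. wprod w x hs)) = avgl V d (\<lambda>hs. (avg V (\<lambda>x. wprod w x hs))\<^sup>2)" for d
  proof -
    have "avg V (\<lambda>h. avg V (\<lambda>x. wprod w x (h # hs))) = (avg V (\<lambda>x. wprod w x hs))\<^sup>2" for hs
    proof -
      have "avg V (\<lambda>h. avg V (\<lambda>x. wprod w x (h # hs)))
          = avg V (\<lambda>x. avg V (\<lambda>h. wprod w x hs * wprod w (x + h) hs))"
        unfolding wprod_Cons by (rule avg_swap)
      also have "\<dots> = avg V (\<lambda>x. wprod w x hs * avg V (\<lambda>h. wprod w h hs))"
        using avg_translate_left[OF V, of _ "\<lambda>h. wprod w h hs"] by (intro avg_cong) (simp add: avg_cmult)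
      finally show ?thesis by (simp add: avg_cmult_right power2_eq_square)
    qed
    then show ?thesis by simp
  qed
  show ?thesis
  proof (induction d)
    case 0
    show ?case unfolding step by (simp add: wprod_def pts_def)
  next
    case (Suc d)
    have "(avg V w) ^ (2 ^ Suc (Suc d)) = ((avg V w) ^ (2 ^ Suc d))\<^sup>2"
      by (simp add: power_mult[symmetric] mult.commute)
    \<comment> \<open>Squaring preserves the inequality because the lower bound is an even
      power.\<close>
    also have "\<dots> \<le> (avgl V (Suc d) (\<lambda>hs. avg V (\<lambda>x. wprod w x hs)))\<^sup>2"
      by (rule power_mono[OF Suc.IH]) (simp add: power_mult)
    also have "\<dots> \<le> avgl V (Suc d) (\<lambda>hs. (avg V (\<lambda>x. wprod w x hs))\<^sup>2)"
      by (rule avgl_square_le[OF V])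
    also have "\<dots> = avgl V (Suc (Suc d)) (\<lambda>hs. avg V (\<lambda>x. wprod w x hs))"
      by (rule step[symmetric])
    finally show ?case .
  qed
qed

text \<open>For symmetric k this is the off-diagonal part of a double sum over the list, diagonal
  meaning equal positions and not equal values.\<close>

fun off :: "('v \<Rightarrow> 'v \<Rightarrow> real) \<Rightarrow> 'v list \<Rightarrow> real" where
  "off k [] = 0"
| "off k (p # ps) = 2 * sum_list (map (k p) ps) + off k ps"

definition cross :: "('v \<Rightarrow> 'v \<Rightarrow> real) \<Rightarrow> 'v list \<Rightarrow> 'v list \<Rightarrow> real" where
  "cross k ps qs = sum_list (map (\<lambda>p. sum_list (map (k p) qs)) ps)"

lemma off_append: "off k (ps @ qs) = off k ps + off k qs + 2 * cross k ps qs"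
  by (induction ps) (simp_all add: cross_def algebra_simps)

lemma off_nonneg: "(\<And>p q. 0 \<le> k p q) \<Longrightarrow> 0 \<le> off k ps"
  by (induction ps) (auto intro!: add_nonneg_nonneg mult_nonneg_nonneg sum_list_nonneg)

lemma off_mono: "(\<And>p q. k p q \<le> l p q) \<Longrightarrow> off k ps \<le> off l ps"
  by (induction ps) (auto intro!: add_mono mult_left_mono sum_list_mono)

lemma off_avg: "off (\<lambda>p q. (\<Sum>j\<in>J. k j p q) / c) ps = (\<Sum>j\<in>J. off (k j) ps) / c"
proof (induction ps)
  case (Cons p ps)
  have "sum_list (map (\<lambda>q. (\<Sum>j\<in>J. k j p q) / c) qs) = (\<Sum>j\<in>J. sum_list (map (k j p) qs)) / c" for qs
    by (induction qs) (simp_all add: sum.distrib add_divide_distrib)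
  then show ?case using Cons by (simp add: sum.distrib add_divide_distrib sum_distrib_left)
qed simp

lemma sum_list_square: "(sum_list (map f ps))\<^sup>2 = sum_list (map (\<lambda>p. (f p)\<^sup>2) ps) + off (\<lambda>p q. f p * f q) ps"
proof (induction ps)
  case (Cons p ps)
  have "sum_list (map (\<lambda>q. f p * f q) ps) = f p * sum_list (map f ps)"
    by (rule sum_list_const_mult)
  then show ?case using Cons by (simp add: power2_eq_square algebra_simps)
qed simp

lemma avg_sum_list: "avg V (\<lambda>x. sum_list (map (\<lambda>a. g a x) as)) = sum_list (map (\<lambda>a. avg V (g a)) as)"
  by (induction as) (simp_all add: avg_add, simp add: avg_def)

text \<open>A box of dimension d + 1 is two boxes of dimension d. For pairs inside one of them the
  other weight is bounded by 1, and induction applies. For a pair across, all weights except those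
  of its two points are bounded by 1. This gives 2 * 4^d + 2 * 4^d = 4^(d + 1).\<close>

lemma avg_wprod_off_le:
  assumes V: "subgrp V" and w: "\<And>x. x \<in> V \<Longrightarrow> 0 \<le> w x \<and> w x \<le> 1" and k: "\<And>x y. 0 \<le> k x y"
  defines "\<kappa> \<equiv> avg V (\<lambda>x. avg V (\<lambda>y. w x * w y * k x y))"
  shows "avgl V d (\<lambda>hs. avg V (\<lambda>x. wprod w x hs * off k (pts x hs))) \<le> 4 ^ d * \<kappa>"
proof (induction d)
  case 0
  have "\<kappa> \<ge> 0" unfolding \<kappa>_def using w k by (intro avg_nonneg mult_nonneg_nonneg) auto
  then show ?case by (simp add: pts_def avg_const[OF V])
next
  case (Suc d)
  define A where "A x hs = wprod w x hs * off k (pts x hs)" for x hs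
  define K where "K x y = w x * w y * k x y" for x y
  have bounds: "0 \<le> wprod w x hs" "wprod w x hs \<le> 1" "\<And>p. p \<in> set (pts x hs) \<Longrightarrow> wprod w x hs \<le> w p"
    if "x \<in> V" "set hs \<subseteq> V" for x hs
    using prod_list_bounds[of "map w (pts x hs)"] set_pts[OF V that(2,1)] w
    by (auto simp: wprod_def subset_iff)
  have pointwise: "A x (h # hs) \<le> A x hs + A (x + h) hs + 2 * cross K (pts x hs) (pts (x + h) hs)"
    if x: "x \<in> V" and h: "h \<in> V" and hs: "set hs \<subseteq> V" for x h hs
  proof -
    have xh: "x + h \<in> V" using x h V by (simp add: subgrp_add)
    let ?a = "wprod w x hs" and ?b = "wprod w (x + h) hs"
    note a = bounds[OF x hs] and b = bounds[OF xh hs]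
    have "?a * ?b * off k (pts x hs) \<le> ?a * off k (pts x hs)"
      using a b off_nonneg[OF k] by (intro mult_right_mono) (simp_all add: mult_left_le)
    moreover have "?a * ?b * off k (pts (x + h) hs) \<le> ?b * off k (pts (x + h) hs)"
      using a b off_nonneg[OF k] by (intro mult_right_mono) (simp_all add: mult_left_le_one_le)
    moreover have "?a * ?b * cross k (pts x hs) (pts (x + h) hs) \<le> cross K (pts x hs) (pts (x + h) hs)"
    proof -
      have "?a * ?b * cross k (pts x hs) (pts (x + h) hs)
          = sum_list (map (\<lambda>p. sum_list (map (\<lambda>q. ?a * ?b * k p q) (pts (x + h) hs))) (pts x hs))"
        by (simp add: cross_def sum_list_const_mult)
      also have "\<dots> \<le> cross K (pts x hs) (pts (x + h) hs)"
        unfolding cross_def K_def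
        using a b k order_trans[OF a(1) a(3)] by (intro sum_list_mono mult_right_mono mult_mono) auto
      finally show ?thesis .
    qed
    ultimately show ?thesis
      by (simp add: A_def wprod_Cons pts_Cons off_append algebra_simps)
  qed
  have cross: "avg V (\<lambda>h. avg V (\<lambda>x. cross K (pts x hs) (pts (x + h) hs))) = 4 ^ d * \<kappa>"
    if hs: "set hs \<subseteq> V" "length hs = d" for hs
  proof -
    \<comment> \<open>As x and h vary, the two vertices x + a and x + h + b are independent and
      uniform.\<close>
    have pair: "avg V (\<lambda>h. avg V (\<lambda>x. K (x + a) (x + h + b))) = \<kappa>" if "a \<in> V" "b \<in> V" for a b
    proof -
      have "avg V (\<lambda>h. avg V (\<lambda>x. K (x + a) (x + h + b))) = avg V (\<lambda>x. avg V (\<lambda>h. K (x + a) ((x + b) + h)))"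
        by (subst avg_swap) (simp add: ac_simps)
      also have "\<dots> = avg V (\<lambda>x. avg V (K (x + a)))"
        using that V by (intro avg_cong avg_translate_left) (auto simp: subgrp_add)
      also have "\<dots> = avg V (\<lambda>x. avg V (K x))"
        using avg_translate[OF V \<open>a \<in> V\<close>, of "\<lambda>x. avg V (K x)"] .
      finally show ?thesis by (simp only: \<kappa>_def K_def[abs_def])
    qed
    have "avg V (\<lambda>h. avg V (\<lambda>x. cross K (pts x hs) (pts (x + h) hs)))
        = sum_list (map (\<lambda>a. sum_list (map (\<lambda>b. avg V (\<lambda>h. avg V (\<lambda>x. K (x + a) (x + h + b)))) (offs hs))) (offs hs))"
      by (simp add: cross_def pts_def comp_def avg_sum_list)
    also have "\<dots> = sum_list (map (\<lambda>a. sum_list (map (\<lambda>b. \<kappa>) (offs hs))) (offs hs))"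
      using set_offs[OF V hs(1)] pair
      by (intro arg_cong[of _ _ sum_list] map_cong refl) auto
    also have "\<dots> = 4 ^ d * \<kappa>"
      by (simp add: sum_list_triv length_offs hs(2) power_mult_distrib[symmetric])
    finally show ?thesis .
  qed
  have "avgl V (Suc d) (\<lambda>hs. avg V (\<lambda>x. A x hs))
      \<le> avgl V d (\<lambda>hs. 2 * avg V (\<lambda>x. A x hs) + 2 * (4 ^ d * \<kappa>))"
    unfolding avgl.simps
  proof (rule avgl_mono)
    fix hs :: "'a list" assume hs: "set hs \<subseteq> V" "length hs = d"
    have "avg V (\<lambda>h. avg V (\<lambda>x. A x (h # hs)))
        \<le> avg V (\<lambda>h. avg V (\<lambda>x. A x hs + A (x + h) hs + 2 * cross K (pts x hs) (pts (x + h) hs)))"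
      by (intro avg_mono pointwise hs)
    also have "\<dots> = avg V (\<lambda>h. avg V (\<lambda>x. A x hs)) + avg V (\<lambda>h. avg V (\<lambda>x. A (x + h) hs))
        + 2 * avg V (\<lambda>h. avg V (\<lambda>x. cross K (pts x hs) (pts (x + h) hs)))"
      by (simp only: avg_add avg_cmult)
    also have "avg V (\<lambda>h. avg V (\<lambda>x. A (x + h) hs)) = avg V (\<lambda>h. avg V (\<lambda>x. A x hs))"
      by (intro avg_cong avg_translate[OF V])
    finally show "avg V (\<lambda>h. avg V (\<lambda>x. A x (h # hs))) \<le> 2 * avg V (\<lambda>x. A x hs) + 2 * (4 ^ d * \<kappa>)"
      using cross[OF hs] by (simp add: avg_const[OF V])
  qed
  also have "\<dots> = 2 * avgl V d (\<lambda>hs. avg V (\<lambda>x. A x hs)) + 2 * (4 ^ d * \<kappa>)"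
    by (simp only: avgl_add avgl_cmult avgl_const[OF V])
  also have "\<dots> \<le> 2 * (4 ^ d * \<kappa>) + 2 * (4 ^ d * \<kappa>)"
    using Suc.IH unfolding A_def by (intro add_right_mono mult_left_mono) simp_all
  also have "\<dots> = 4 ^ Suc d * \<kappa>" by simp
  finally show ?case by (simp add: A_def)
qed

text \<open>On a parallelepiped the restriction of every cubic has bias at distance at least \<open>\<eta>\<close> from 1/3,
  while weights concentrated on typical pairs would force the mean square of that distance to be tiny.\<close>

lemma weighted_correlation_ge:
  fixes V :: "'v::char2_group set"
  assumes V: "subgrp V" and n: "n > 0" and Q: "\<And>j. j < n \<Longrightarrow> deg_le 3 V (Q j)"
    and w: "\<And>x. x \<in> V \<Longrightarrow> 0 \<le> w x \<and> w x \<le> 1"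
    and \<eta>: "\<eta> > 0" and d: "4 \<le> 2 ^ Suc d * \<eta>\<^sup>2"
    and gap: "\<And>(H :: 'v set) f. subgrp H \<Longrightarrow> deg_le 3 H f \<Longrightarrow> \<bar>bias H f - 1/3\<bar> \<ge> \<eta>"
  shows "\<eta>\<^sup>2 / 2 * (avg V w) ^ (2 ^ Suc d) \<le>
    avg V (\<lambda>x. avg V (\<lambda>y. w x * w y * \<bar>(\<Sum>j<n. (chi (Q j x) - 1/3) * (chi (Q j y) - 1/3)) / real n\<bar>))"
    (is "_ \<le> ?R")
proof -
  define D where "D = Suc d"
  define u where "u j x = chi (Q j x) - 1/3" for j x
  define G where "G x y = (\<Sum>j<n. u j x * u j y) / real n" for x y
  have lower: "4 ^ D * \<eta>\<^sup>2 / 2 \<le> off (\<lambda>x y. \<bar>G x y\<bar>) (pts x hs)"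
    if x: "x \<in> V" and hs: "set hs \<subseteq> V" "length hs = D" for x hs
  proof -
    obtain H where H: "subgrp H" "H \<subseteq> V"
        "\<And>g :: 'v \<Rightarrow> real. sum_list (map g (offs hs)) = 2 ^ length hs * avg H g"
      using sum_offs_eq_subgrp[OF V hs(1)] by blast
    \<comment> \<open>The vertex sum of \<open>u j\<close> is 2^D times (bias - 1/3) for a translate
      of \<open>Q j\<close> on the span H. The gap bounds its square from below; expanding the
      square separates diagonal and off-diagonal pairs.\<close>
    have j: "4 ^ D * \<eta>\<^sup>2 \<le> 2 * 2 ^ D + off (\<lambda>p q. u j p * u j q) (pts x hs)" if "j < n" for j
    proof -
      have "deg_le 3 H (\<lambda>y. Q j (x + y))"
        by (intro deg_le_subset[OF _ H(2)] deg_le_translate V x Q that)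
      then have "\<eta>\<^sup>2 \<le> (bias H (\<lambda>y. Q j (x + y)) - 1/3)\<^sup>2"
        using gap[OF H(1)] \<eta> by (metis abs_le_square_iff abs_of_pos)
      moreover have "sum_list (map (u j) (pts x hs)) = 2 ^ D * (bias H (\<lambda>y. Q j (x + y)) - 1/3)"
      proof -
        have "sum_list (map (u j) (pts x hs)) = 2 ^ D * avg H (\<lambda>y. u j (x + y))"
          using H(3)[of "\<lambda>y. u j (x + y)"] hs by (simp add: pts_def comp_def)
        also have "avg H (\<lambda>y. u j (x + y)) = bias H (\<lambda>y. Q j (x + y)) - 1/3"
          using subgrp_card_pos[OF H(1)]
          by (simp add: avg_def bias_def u_def sum_subtractf diff_divide_distrib)
        finally show ?thesis .
      qed
      ultimately have "4 ^ D * \<eta>\<^sup>2 \<le> (sum_list (map (u j) (pts x hs)))\<^sup>2"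
        by (simp add: power_mult_distrib flip: power_mult) (simp add: power_mult mult.commute[of D])
      also have "\<dots> = sum_list (map (\<lambda>p. (u j p)\<^sup>2) (pts x hs)) + off (\<lambda>p q. u j p * u j q) (pts x hs)"
        by (rule sum_list_square)
      \<comment> \<open>The values of \<open>u j\<close> are 2/3 and -4/3, with squares at most
        16/9.\<close>
      also have "sum_list (map (\<lambda>p. (u j p)\<^sup>2) (pts x hs)) \<le> sum_list (map (\<lambda>p. 2) (pts x hs))"
        by (intro sum_list_mono) (auto simp: u_def chi_def power2_eq_square)
      also have "\<dots> = 2 * 2 ^ D" by (simp add: sum_list_triv length_pts hs)
      finally show ?thesis by simp
    qed
    have "4 ^ D * \<eta>\<^sup>2 = (\<Sum>j<n. 4 ^ D * \<eta>\<^sup>2) / real n" using n by simp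
    also have "\<dots> \<le> (\<Sum>j<n. 2 * 2 ^ D + off (\<lambda>p q. u j p * u j q) (pts x hs)) / real n"
      using j by (intro divide_right_mono sum_mono) auto
    also have "\<dots> = 2 * 2 ^ D + off G (pts x hs)"
      using n unfolding G_def off_avg by (simp add: sum.distrib add_divide_distrib)
    also have "off G (pts x hs) \<le> off (\<lambda>x y. \<bar>G x y\<bar>) (pts x hs)" by (rule off_mono) simp
    finally have "4 ^ D * \<eta>\<^sup>2 \<le> 2 * 2 ^ D + off (\<lambda>x y. \<bar>G x y\<bar>) (pts x hs)" by simp
    \<comment> \<open>The choice of d makes the diagonal at most half of the total.\<close>
    moreover have "2 ^ D * 4 \<le> 2 ^ D * (2 ^ D * \<eta>\<^sup>2)" using d by (intro mult_left_mono) (simp_all add: D_def)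
    then have "2 * 2 ^ D \<le> 4 ^ D * \<eta>\<^sup>2 / 2"
      by (simp flip: mult.assoc power_mult_distrib)
    ultimately show ?thesis by linarith
  qed
  have "4 ^ D * (\<eta>\<^sup>2 / 2 * (avg V w) ^ (2 ^ D)) \<le> 4 ^ D * \<eta>\<^sup>2 / 2 * avgl V D (\<lambda>hs. avg V (\<lambda>x. wprod w x hs))"
    using mult_left_mono[OF avg_wprod_ge[OF V, of w d], of "4 ^ D * \<eta>\<^sup>2 / 2"] by (simp add: D_def)
  also have "\<dots> = avgl V D (\<lambda>hs. avg V (\<lambda>x. 4 ^ D * \<eta>\<^sup>2 / 2 * wprod w x hs))"
    by (simp only: avgl_cmult avg_cmult)
  also have "\<dots> \<le> avgl V D (\<lambda>hs. avg V (\<lambda>x. wprod w x hs * off (\<lambda>x y. \<bar>G x y\<bar>) (pts x hs)))"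
  proof (intro avgl_mono avg_mono)
    fix hs :: "'v list" and x assume hs: "set hs \<subseteq> V" "length hs = D" and x: "x \<in> V"
    have "0 \<le> wprod w x hs"
      unfolding wprod_def using prod_list_bounds[of "map w (pts x hs)"] set_pts[OF V hs(1) x] w
      by (auto simp: subset_iff)
    then show "4 ^ D * \<eta>\<^sup>2 / 2 * wprod w x hs \<le> wprod w x hs * off (\<lambda>x y. \<bar>G x y\<bar>) (pts x hs)"
      using lower[OF x hs] by (subst mult.commute) (rule mult_left_mono)
  qed
  also have "\<dots> \<le> 4 ^ D * avg V (\<lambda>x. avg V (\<lambda>y. w x * w y * \<bar>G x y\<bar>))"
    by (rule avg_wprod_off_le[OF V w]) auto
  also have "avg V (\<lambda>x. avg V (\<lambda>y. w x * w y * \<bar>G x y\<bar>)) = ?R"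
    by (simp add: G_def u_def)
  finally show ?thesis by (simp only: D_def mult_le_cancel_left_pos zero_less_power zero_less_numeral)
qed

section \<open>Sums over the cube and the product distribution\<close>

lemma cube_0: "cube 0 = {\<lambda>i. False}"
  by (auto simp: cube_def)

lemma cube_Suc: "cube (Suc n) = cube n \<union> (\<lambda>y. y(n := True)) ` cube n"
proof (intro equalityI subsetI)
  fix y assume y: "y \<in> cube (Suc n)"
  show "y \<in> cube n \<union> (\<lambda>y. y(n := True)) ` cube n"
  proof (cases "y n")
    case True
    then have "y = (y(n := False))(n := True)" by (auto simp: fun_eq_iff)
    moreover have "y(n := False) \<in> cube n" using y by (auto simp: cube_def Suc_le_eq)
    ultimately show ?thesis by blast
  next
    case False
    then show ?thesis using y by (auto simp: cube_def Suc_le_eq) (metis le_neq_implies_less)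
  qed
qed (auto simp: cube_def)

lemma finite_cube: "finite (cube n)"
  by (induction n) (auto simp: cube_0 cube_Suc)

lemma sum_cube_Suc:
  fixes g :: "(nat \<Rightarrow> bool) \<Rightarrow> 'b::comm_monoid_add"
  shows "(\<Sum>y\<in>cube (Suc n). g y) = (\<Sum>y\<in>cube n. g y + g (y(n := True)))"
proof -
  have "inj_on (\<lambda>y. y(n := True)) (cube n)"
  proof (rule inj_onI)
    fix x y assume xy: "x \<in> cube n" "y \<in> cube n" "x(n := True) = y(n := True)"
    show "x = y"
    proof
      fix i show "x i = y i"
        using xy(1,2) fun_cong[OF xy(3), of i] by (cases "i = n") (auto simp: cube_def)
    qed
  qed
  moreover have "cube n \<inter> (\<lambda>y. y(n := True)) ` cube n = {}" by (auto simp: cube_def)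
  ultimately show ?thesis
    by (simp add: cube_Suc sum.union_disjoint finite_cube sum.reindex sum.distrib)
qed

lemma card_cube: "card (cube n) = 2 ^ n"
proof (induction n)
  case (Suc n)
  have "card (cube (Suc n)) = (\<Sum>y\<in>cube (Suc n). 1)" by simp
  also have "\<dots> = 2 ^ Suc n" unfolding sum_cube_Suc using Suc by simp
  finally show ?case .
qed (simp add: cube_0)

lemma sum_prod_cube:
  fixes F :: "nat \<Rightarrow> bool \<Rightarrow> real"
  shows "(\<Sum>y\<in>cube n. \<Prod>i<n. F i (y i)) = (\<Prod>i<n. F i True + F i False)"
proof (induction n)
  case (Suc n)
  have "(\<Sum>y\<in>cube (Suc n). \<Prod>i<Suc n. F i (y i)) =
        (\<Sum>y\<in>cube n. (\<Prod>i<n. F i (y i)) * (F n True + F n False))"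
    unfolding sum_cube_Suc
  proof (rule sum.cong[OF refl])
    fix y assume "y \<in> cube n"
    then have "\<not> y n" by (simp add: cube_def)
    moreover have "(\<Prod>i<n. F i ((y(n := True)) i)) = (\<Prod>i<n. F i (y i))" by (intro prod.cong) auto
    ultimately show "(\<Prod>i<Suc n. F i (y i)) + (\<Prod>i<Suc n. F i ((y(n := True)) i)) =
        (\<Prod>i<n. F i (y i)) * (F n True + F n False)"
      by (simp add: algebra_simps)
  qed
  then show ?case by (simp add: Suc flip: sum_distrib_right)
qed (simp add: cube_0)

section \<open>The Bernoulli product and its second moments\<close>

lemma ber13_prod_eq: "ber13_prod n y = (\<Prod>i<n. if y i then 1/3 else 2/3)"
proof -
  have "(\<Prod>i<n. if y i then 1/3 else 2/3 :: real)
      = (1/3) ^ card ({..<n} \<inter> {i. y i}) * (2/3) ^ card ({..<n} \<inter> - {i. y i})"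
    by (simp add: prod.If_cases)
  also have "{..<n} \<inter> {i. y i} = {i. i < n \<and> y i}" by auto
  also have "{..<n} \<inter> - {i. y i} = {..<n} - {i. i < n \<and> y i}" by auto
  also have "card \<dots> = n - card {i. i < n \<and> y i}"
    by (subst card_Diff_subset) auto
  finally show ?thesis by (simp add: ber13_prod_def)
qed

lemma ber13_prod_nonneg: "0 \<le> ber13_prod n y"
  by (simp add: ber13_prod_def)

lemma sum_ber13_prod: "(\<Sum>y\<in>cube n. ber13_prod n y) = 1"
  unfolding ber13_prod_eq using sum_prod_cube[of "\<lambda>i b. if b then 1/3 else 2/3" n] by simp

text \<open>\<open>(-1)^b - 1/3\<close>, which has mean zero under Ber(1/3).\<close>

definition csgn :: "bool \<Rightarrow> real" where
  "csgn b = (if b then - 4/3 else 2/3)"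

text \<open>Both signs are absorbed into the coordinate factors. For i = j one factor becomes the
  variance 1/3 * 16/9 + 2/3 * 4/9 = 8/9; otherwise the factor at i is the mean 0.\<close>

lemma ber13_prod_covariance:
  assumes "i < n" "j < n"
  shows "(\<Sum>y\<in>cube n. ber13_prod n y * (csgn (y i) * csgn (y j))) = (if i = j then 8/9 else 0)"
proof -
  define F where "F k b = (if b then 1/3 else 2/3) * ((if k = i then csgn b else 1) * (if k = j then csgn b else 1))"
    for k b
  have "ber13_prod n y * (csgn (y i) * csgn (y j)) = (\<Prod>k<n. F k (y k))" for y
    using assms by (simp add: F_def ber13_prod_eq prod.distrib)
  then have "(\<Sum>y\<in>cube n. ber13_prod n y * (csgn (y i) * csgn (y j))) = (\<Prod>k<n. F k True + F k False)"
    by (simp add: sum_prod_cube)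
  also have "\<dots> = (if i = j then 8/9 else 0)"
  proof (cases "i = j")
    case True
    then have "(\<Prod>k<n. F k True + F k False) = (\<Prod>k<n. if k = i then 8/9 else 1)"
      by (intro prod.cong) (auto simp: F_def csgn_def)
    then show ?thesis using True assms by simp
  next
    case False
    then have "F i True + F i False = 0" by (simp add: F_def csgn_def)
    then show ?thesis using False assms by (auto intro!: prod_zero)
  qed
  finally show ?thesis .
qed

lemma ber13_prod_variance:
  "(\<Sum>y\<in>cube n. ber13_prod n y * (\<Sum>j<n. c j * csgn (y j))\<^sup>2) = 8/9 * (\<Sum>j<n. (c j)\<^sup>2)"
proof -
  have "(\<Sum>y\<in>cube n. ber13_prod n y * (\<Sum>j<n. c j * csgn (y j))\<^sup>2)
      = (\<Sum>y\<in>cube n. \<Sum>i<n. \<Sum>j<n. c i * c j * (ber13_prod n y * (csgn (y i) * csgn (y j))))"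
    by (simp add: power2_eq_square sum_product sum_distrib_left mult_ac)
  also have "\<dots> = (\<Sum>i<n. \<Sum>j<n. \<Sum>y\<in>cube n. c i * c j * (ber13_prod n y * (csgn (y i) * csgn (y j))))"
    by (subst sum.swap, rule sum.cong[OF refl], rule sum.swap)
  also have "\<dots> = (\<Sum>i<n. \<Sum>j<n. c i * c j * (if i = j then 8/9 else 0))"
    by (intro sum.cong refl) (simp add: ber13_prod_covariance flip: sum_distrib_left)
  also have "\<dots> = (\<Sum>i<n. \<Sum>j<n. if j = i then 8/9 * (c i)\<^sup>2 else 0)"
    by (intro sum.cong refl) (auto simp: power2_eq_square)
  also have "\<dots> = (\<Sum>i<n. 8/9 * (c i)\<^sup>2)" by simp
  finally show ?thesis by (simp add: sum_distrib_left)
qed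

text \<open>For fixed y the correlation is a linear form in the centred signs of z, so two variance
  computations give the second moment (8/9)^2 / n.\<close>

lemma ber13_prod_correlation_le:
  assumes n: "n > 0"
  shows "(\<Sum>y\<in>cube n. \<Sum>z\<in>cube n. ber13_prod n y * ber13_prod n z * \<bar>(\<Sum>j<n. csgn (y j) * csgn (z j)) / real n\<bar>)
           \<le> 1 / sqrt (real n)" (is "?L \<le> _")
proof -
  define G where "G y z = (\<Sum>j<n. csgn (y j) * csgn (z j)) / real n" for y z
  let ?B = "ber13_prod n"
  have inner: "(\<Sum>z\<in>cube n. ?B z * (G y z)\<^sup>2) = 8/9 * (\<Sum>j<n. (csgn (y j))\<^sup>2) / (real n)\<^sup>2" for y
    unfolding ber13_prod_variance[of n "\<lambda>j. csgn (y j)", symmetric]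
    by (subst sum_divide_distrib) (simp add: G_def power_divide)
  have "(\<Sum>y\<in>cube n. ?B y * (\<Sum>j<n. (csgn (y j))\<^sup>2)) = (\<Sum>j<n. \<Sum>y\<in>cube n. ?B y * (csgn (y j) * csgn (y j)))"
    by (simp add: sum_distrib_left power2_eq_square) (rule sum.swap)
  also have "\<dots> = (\<Sum>j<n. 8/9)"
    by (intro sum.cong refl) (use ber13_prod_covariance in simp)
  finally have outer: "(\<Sum>y\<in>cube n. ?B y * (\<Sum>j<n. (csgn (y j))\<^sup>2)) = 8/9 * real n" by simp
  have "(\<Sum>y\<in>cube n. \<Sum>z\<in>cube n. ?B y * ?B z * (G y z)\<^sup>2)
      = (\<Sum>y\<in>cube n. ?B y * (\<Sum>z\<in>cube n. ?B z * (G y z)\<^sup>2))"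
    by (simp add: sum_distrib_left mult.assoc)
  also have "\<dots> = 8/9 / (real n)\<^sup>2 * (\<Sum>y\<in>cube n. ?B y * (\<Sum>j<n. (csgn (y j))\<^sup>2))"
    unfolding inner sum_distrib_left[of "8/9 / (real n)\<^sup>2"] by (intro sum.cong refl) simp
  also have "\<dots> \<le> 1 / real n"
    unfolding outer using n by (simp add: power2_eq_square field_simps)
  finally have sq: "(\<Sum>y\<in>cube n. \<Sum>z\<in>cube n. ?B y * ?B z * (G y z)\<^sup>2) \<le> 1 / real n" .
  \<comment> \<open>The weight s balances the two halves of the AM-GM bound, which replaces
    Cauchy-Schwarz in passing from the second moment to the first.\<close>
  define s where "s = sqrt (real n)"
  have s: "s > 0" "s * s = real n" using n by (simp_all add: s_def)
  have amgm: "\<bar>g\<bar> \<le> (s * g\<^sup>2 + 1 / s) / 2" for g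
  proof -
    have "0 \<le> (s * \<bar>g\<bar> - 1)\<^sup>2" by simp
    then have "2 * (s * \<bar>g\<bar>) \<le> s * s * g\<^sup>2 + 1" by (simp add: power2_eq_square algebra_simps)
    then show ?thesis using s(1) by (simp add: field_simps)
  qed
  have "?L \<le> (\<Sum>y\<in>cube n. \<Sum>z\<in>cube n. ?B y * ?B z * ((s * (G y z)\<^sup>2 + 1 / s) / 2))"
    unfolding G_def[symmetric]
    by (intro sum_mono mult_left_mono amgm mult_nonneg_nonneg ber13_prod_nonneg)
  also have "\<dots> = (\<Sum>y\<in>cube n. \<Sum>z\<in>cube n. s / 2 * (?B y * ?B z * (G y z)\<^sup>2) + 1 / (2 * s) * (?B y * ?B z))"
    by (intro sum.cong refl) (simp add: field_simps)
  also have "\<dots> = s / 2 * (\<Sum>y\<in>cube n. \<Sum>z\<in>cube n. ?B y * ?B z * (G y z)\<^sup>2) + 1 / (2 * s)"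
    by (simp only: sum.distrib sum_distrib_left[symmetric] sum_ber13_prod mult_1_right)
  also have "\<dots> \<le> s / 2 * (1 / real n) + 1 / (2 * s)"
    using sq s(1) by (intro add_right_mono mult_left_mono) auto
  also have "\<dots> = 1 / s" unfolding s(2)[symmetric] using s(1) by (simp add: field_simps)
  finally show ?thesis by (simp add: s_def)
qed

section \<open>Polynomials on the cube\<close>

text \<open>The cube with values in \<open>bit\<close>, where the pointwise group structure is
  available.\<close>

definition bitcube :: "nat \<Rightarrow> (nat \<Rightarrow> bit) set" where
  "bitcube m = {v. \<forall>i\<ge>m. v i = 0}"

definition to_bool :: "(nat \<Rightarrow> bit) \<Rightarrow> nat \<Rightarrow> bool" where
  "to_bool v i \<longleftrightarrow> v i = 1"

lemma bij_betw_to_bool: "bij_betw to_bool (bitcube m) (cube m)"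
  by (rule bij_betw_byWitness[of _ "\<lambda>x i. of_bool (x i)"])
     (auto simp: bitcube_def cube_def to_bool_def fun_eq_iff)

lemma subgrp_bitcube: "subgrp (bitcube m)"
proof -
  have "finite (bitcube m)"
    using bij_betw_finite[OF bij_betw_to_bool] finite_cube by blast
  then show ?thesis by (auto simp: subgrp_def bitcube_def)
qed

lemma avg_bitcube: "avg (bitcube m) (\<lambda>v. g (to_bool v)) = (\<Sum>x\<in>cube m. g x) / 2 ^ m"
  using sum.reindex_bij_betw[OF bij_betw_to_bool, of g m] bij_betw_same_card[OF bij_betw_to_bool, of m]
  by (simp add: avg_def card_cube)

lemma deg_le_const: "subgrp V \<Longrightarrow> deg_le k V (\<lambda>x. c)"
proof (induction k)
  case (Suc k)
  then show ?case by (intro deg_le_Suc)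
qed auto

lemma deg_le_mono:
  assumes "subgrp V" "deg_le k V f" "k \<le> l"
  shows "deg_le l V f"
  using assms(3,2) by (induction rule: dec_induct) (auto intro: deg_le_Suc[OF assms(1)] simp del: deg_le.simps)

lemma deg_le_cmult: "subgrp V \<Longrightarrow> deg_le k V f \<Longrightarrow> deg_le k V (\<lambda>x. c * f x)"
  using deg_le_const[of V k 0] by (cases c) simp_all

lemma deg_le_sum:
  "subgrp V \<Longrightarrow> (\<And>S. S \<in> C \<Longrightarrow> deg_le k V (f S)) \<Longrightarrow> deg_le k V (\<lambda>x. \<Sum>S\<in>C. f S x)"
proof (induction C rule: infinite_finite_induct)
  case (insert S C)
  then show ?case by (simp add: deg_le_add del: deg_le.simps)
qed (simp_all add: deg_le_const del: deg_le.simps)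

text \<open>By the product rule D, the derivative of x_i g is x_i times a derivative of g plus a
  constant multiple of a translate of g; induct on the degree of g.\<close>

lemma deg_le_coord_mult:
  assumes "subgrp V" "deg_le k V g"
  shows "deg_le (Suc k) V (\<lambda>x :: nat \<Rightarrow> bit. x i * g x)"
  using assms(2)
proof (induction k arbitrary: g)
  have D: "diff h (\<lambda>x. x i * g x) = (\<lambda>x. x i * diff h g x + h i * g (h + x))" for h :: "nat \<Rightarrow> bit" and g
  proof
    fix x :: "nat \<Rightarrow> bit"
    show "diff h (\<lambda>x. x i * g x) x = x i * diff h g x + h i * g (h + x)"
      unfolding diff_def by (simp add: algebra_simps)
  qed
  {
    case 0
    have "deg_le 0 V (\<lambda>x. x i * diff h g x + h i * g (h + x))" if h: "h \<in> V" for h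
    proof (rule deg_le_add)
      have "x i * diff h g x = 0" if x: "x \<in> V" for x
      proof -
        have "g (x + h) = g 0" by (rule deg_le_0_D[OF assms(1) 0 subgrp_add[OF assms(1) x h]])
        moreover have "g x = g 0" by (rule deg_le_0_D[OF assms(1) 0 x])
        ultimately have "diff h g x = 0" unfolding diff_def by (simp only: add_self)
        then show ?thesis by simp
      qed
      then show "deg_le 0 V (\<lambda>x. x i * diff h g x)" unfolding deg_le.simps by blast
      show "deg_le 0 V (\<lambda>x. h i * g (h + x))"
        by (intro deg_le_cmult deg_le_translate assms(1) h 0)
    qed
    then show ?case unfolding deg_le.simps(2) D by blast
  next
    case (Suc k)
    have "deg_le (Suc k) V (diff h (\<lambda>x. x i * g x))" if h: "h \<in> V" for h
      unfolding D
    proof (rule deg_le_add)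
      show "deg_le (Suc k) V (\<lambda>x. x i * diff h g x)"
        using Suc.prems h by (intro Suc.IH) simp
      show "deg_le (Suc k) V (\<lambda>x. h i * g (h + x))"
        by (intro deg_le_cmult deg_le_translate assms(1) h Suc.prems)
    qed
    then show ?case by (subst deg_le.simps(2)) blast
  }
qed

lemma deg_le_monomial:
  "finite S \<Longrightarrow> subgrp V \<Longrightarrow> deg_le (card S) V (\<lambda>x :: nat \<Rightarrow> bit. \<Prod>i\<in>S. x i)"
proof (induction S rule: finite_induct)
  case (insert i S)
  then show ?case using deg_le_coord_mult[of V "card S"] by (simp del: deg_le.simps)
qed (simp add: deg_le_const del: deg_le.simps)

lemma of_nat_bit_eq: "(of_nat n :: bit) = of_bool (odd n)"
  by (induction n) (auto simp: add_bit_eq_xor)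

text \<open>The parity of the number of satisfied monomials is their sum in \<open>bit\<close>, so
  the claim reduces to single monomials.\<close>

lemma f2_poly_deg_le_imp_deg_le:
  assumes "f2_poly_deg_le m k f"
  shows "deg_le k (bitcube m) (\<lambda>v. of_bool (f (to_bool v)))"
proof -
  let ?V = "bitcube m"
  obtain C where C: "C \<subseteq> {S. S \<subseteq> {..<m} \<and> card S \<le> k}"
      "\<And>x. x \<in> cube m \<Longrightarrow> f x = odd (card {S\<in>C. \<forall>i\<in>S. x i})"
    using assms unfolding f2_poly_deg_le_def by blast
  have finC: "finite C" by (rule finite_subset[of _ "Pow {..<m}"]) (use C(1) in auto)
  have finS: "finite S" if "S \<in> C" for S using C(1) that finite_subset[of S "{..<m}"] by auto
  have deg: "deg_le k ?V (\<lambda>v. \<Sum>S\<in>C. \<Prod>i\<in>S. v i)"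
  proof (rule deg_le_sum[OF subgrp_bitcube])
    fix S assume S: "S \<in> C"
    show "deg_le k ?V (\<lambda>v. \<Prod>i\<in>S. v i)"
      by (rule deg_le_mono[OF subgrp_bitcube deg_le_monomial[OF finS[OF S] subgrp_bitcube]]) (use C(1) S in auto)
  qed
  have "(\<Sum>S\<in>C. \<Prod>i\<in>S. v i) = of_bool (f (to_bool v))" if v: "v \<in> ?V" for v
  proof -
    have "(\<Prod>i\<in>S. v i) = of_bool (\<forall>i\<in>S. v i = 1)" if "S \<in> C" for S
      using finS[OF that] by (induction S rule: finite_induct) auto
    then have "(\<Sum>S\<in>C. \<Prod>i\<in>S. v i) = (\<Sum>S\<in>C. of_bool (\<forall>i\<in>S. v i = 1))" by (rule sum.cong[OF refl])
    also have "\<dots> = of_nat (card {S\<in>C. \<forall>i\<in>S. v i = 1})"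
      using finC by (simp add: sum.inter_filter[symmetric] of_bool_def)
    also have "\<dots> = of_bool (f (to_bool v))"
      using C(2)[of "to_bool v"] bij_betw_apply[OF bij_betw_to_bool v]
      by (simp add: of_nat_bit_eq to_bool_def)
    finally show ?thesis .
  qed
  then show ?thesis by (rule deg_le_cong[OF subgrp_bitcube _ deg])
qed

section \<open>The overlap of the two distributions\<close>

definition outputs :: "nat \<Rightarrow> (nat \<Rightarrow> (nat \<Rightarrow> bool) \<Rightarrow> bool) \<Rightarrow> (nat \<Rightarrow> bool) \<Rightarrow> nat \<Rightarrow> bool" where
  "outputs n P x = (\<lambda>i. if i < n then P i x else False)"

lemma sum_poly_dist:
  "(\<Sum>x\<in>cube m. g (outputs n P x)) / 2 ^ m = (\<Sum>y\<in>cube n. poly_dist m n P y * g y)"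
proof -
  have "(\<Sum>x\<in>cube m. g (outputs n P x))
      = (\<Sum>y\<in>cube n. \<Sum>x\<in>{x\<in>cube m. outputs n P x = y}. g (outputs n P x))"
    by (rule sum.group[symmetric, OF finite_cube finite_cube]) (auto simp: outputs_def cube_def)
  also have "\<dots> = (\<Sum>y\<in>cube n. real (card {x\<in>cube m. outputs n P x = y}) * g y)"
    by (intro sum.cong refl) simp
  finally show ?thesis
    by (simp add: poly_dist_def outputs_def sum_divide_distrib)
qed

definition overlap :: "nat \<Rightarrow> nat \<Rightarrow> (nat \<Rightarrow> (nat \<Rightarrow> bool) \<Rightarrow> bool) \<Rightarrow> real" where
  "overlap m n P = (\<Sum>y\<in>cube n. min (poly_dist m n P y) (ber13_prod n y))"

lemma tv_dist_eq_overlap: "tv_dist n (poly_dist m n P) (ber13_prod n) = 1 - overlap m n P"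
proof -
  have 1: "(\<Sum>y\<in>cube n. poly_dist m n P y) = 1"
    using sum_poly_dist[where g = "\<lambda>_. 1" and m = m and n = n and P = P] by (simp add: card_cube)
  have "\<bar>a - b\<bar> = a + b - 2 * min a b" for a b :: real by (simp add: min_def)
  then have "(\<Sum>y\<in>cube n. \<bar>poly_dist m n P y - ber13_prod n y\<bar>) = 2 - 2 * overlap m n P"
    by (simp add: overlap_def sum.distrib sum_subtractf 1 sum_ber13_prod flip: sum_distrib_left)
  then show ?thesis by (simp add: tv_dist_def)
qed

text \<open>The weight at an input is the share of its output mass that survives in the minimum. Its
  mean is the overlap, and pushed forward to outputs it is dominated by the Bernoulli
  product.\<close>

lemma overlap_power_le:
  assumes n: "n > 0" and P: "\<And>i. i < n \<Longrightarrow> f2_poly_deg_le m 3 (P i)"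
    and \<eta>: "\<eta> > 0" and d: "4 \<le> 2 ^ Suc d * \<eta>\<^sup>2"
    and gap: "\<And>(H :: (nat \<Rightarrow> bit) set) f. subgrp H \<Longrightarrow> deg_le 3 H f \<Longrightarrow> \<bar>bias H f - 1/3\<bar> \<ge> \<eta>"
  shows "\<eta>\<^sup>2 / 2 * (overlap m n P) ^ (2 ^ Suc d) \<le> 1 / sqrt (real n)"
proof -
  let ?D = "poly_dist m n P" and ?B = "ber13_prod n" and ?V = "bitcube m"
  \<comment> \<open>Division by zero yields 0 at outputs of mass 0, consistent with the minimum
    being 0 there.\<close>
  define \<rho> where "\<rho> y = min (?D y) (?B y) / ?D y" for y
  define Y where "Y v = outputs n P (to_bool v)" for v
  define G where "G y z = (\<Sum>j<n. csgn (y j) * csgn (z j)) / real n" for y z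
  have D0: "?D y \<ge> 0" for y by (simp add: poly_dist_def)
  have \<rho>: "0 \<le> \<rho> y" "\<rho> y \<le> 1" "?D y * \<rho> y = min (?D y) (?B y)" for y
    using D0[of y] ber13_prod_nonneg[of n y] by (auto simp: \<rho>_def divide_le_eq_1 min_def)
  have push: "avg ?V (\<lambda>v. g (Y v)) = (\<Sum>y\<in>cube n. ?D y * g y)" for g
    using avg_bitcube[of m "\<lambda>x. g (outputs n P x)"] sum_poly_dist[of g] by (simp add: Y_def)
  have chi: "chi (of_bool (P j (to_bool v))) - 1/3 = csgn (Y v j)" if "j < n" for j v
    using that by (simp add: Y_def outputs_def csgn_def)
  have "\<eta>\<^sup>2 / 2 * (avg ?V (\<lambda>v. \<rho> (Y v))) ^ (2 ^ Suc d) \<le>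
    avg ?V (\<lambda>u. avg ?V (\<lambda>v. \<rho> (Y u) * \<rho> (Y v) *
      \<bar>(\<Sum>j<n. (chi (of_bool (P j (to_bool u))) - 1/3) * (chi (of_bool (P j (to_bool v))) - 1/3)) / real n\<bar>))"
    by (rule weighted_correlation_ge[OF subgrp_bitcube n f2_poly_deg_le_imp_deg_le[OF P] _ \<eta> d gap])
       (use \<rho> in auto)
  also have "\<dots> = avg ?V (\<lambda>u. avg ?V (\<lambda>v. \<rho> (Y u) * \<rho> (Y v) * \<bar>G (Y u) (Y v)\<bar>))"
    by (simp add: chi G_def)
  also have "\<dots> = avg ?V (\<lambda>u. \<Sum>z\<in>cube n. ?D z * (\<rho> (Y u) * \<rho> z * \<bar>G (Y u) z\<bar>))"
    by (intro avg_cong push)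
  also have "\<dots> = (\<Sum>y\<in>cube n. ?D y * (\<Sum>z\<in>cube n. ?D z * (\<rho> y * \<rho> z * \<bar>G y z\<bar>)))"
    by (rule push)
  also have "\<dots> = (\<Sum>y\<in>cube n. \<Sum>z\<in>cube n. (?D y * \<rho> y) * (?D z * \<rho> z) * \<bar>G y z\<bar>)"
    by (simp add: sum_distrib_left mult_ac)
  \<comment> \<open>The minimum is replaced by the Bernoulli mass in both independent
    copies.\<close>
  also have "\<dots> \<le> (\<Sum>y\<in>cube n. \<Sum>z\<in>cube n. ?B y * ?B z * \<bar>G y z\<bar>)"
    unfolding \<rho>(3)
    by (intro sum_mono mult_right_mono mult_mono) (auto simp: ber13_prod_nonneg D0)
  also have "\<dots> \<le> 1 / sqrt (real n)"
    unfolding G_def by (rule ber13_prod_correlation_le[OF n])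
  also have "avg ?V (\<lambda>v. \<rho> (Y v)) = overlap m n P"
    unfolding push \<rho>(3) overlap_def ..
  finally show ?thesis .
qed

section \<open>Asymptotic comparison and conclusion\<close>

lemma eventually_power_bound:
  fixes C :: real and k :: nat
  assumes "C > 0" "k > 0"
  shows "eventually (\<lambda>n :: nat. 1 / sqrt (real n) < C * (2 powr (- 1 * sqrt (log 2 (log 2 (real n))))) ^ k) sequentially"
proof -
  define a where "a = real k"
  have a: "a > 0" using assms by (simp add: a_def)
  \<comment> \<open>On the logarithmic scale, log n / 2 eventually exceeds any constant multiple of
    sqrt (log log n) plus a constant.\<close>
  have "eventually (\<lambda>n :: nat. 1 / sqrt (real n) < C * 2 powr (- a * sqrt (log 2 (log 2 (real n))))) sequentially"
    using assms a by real_asymp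
  then show ?thesis by (simp add: powr_power a_def mult.commute)
qed

theorem theorem11p1:
  shows "\<exists>c::real. c > 0 \<and> (\<exists>N::nat. \<forall>n\<ge>N. \<forall>m::nat. \<forall>P :: nat \<Rightarrow> (nat \<Rightarrow> bool) \<Rightarrow> bool.
           (\<forall>i<n. f2_poly_deg_le m 3 (P i)) \<longrightarrow>
           tv_dist n (poly_dist m n P) (ber13_prod n)
             \<ge> 1 - 2 powr (- c * sqrt (log 2 (log 2 (real n)))))"
proof -
  obtain \<eta> :: real where \<eta>: "\<eta> > 0"
    "\<And>(H :: (nat \<Rightarrow> bit) set) f. subgrp H \<Longrightarrow> deg_le 3 H f \<Longrightarrow> \<bar>bias H f - 1/3\<bar> \<ge> \<eta>"
    using cubic_bias_gap by blast
  \<comment> \<open>The box dimension depends on the gap \<eta> only, so the power K of the overlap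
    is an absolute constant.\<close>
  obtain d :: nat where "4 / \<eta>\<^sup>2 < 2 ^ d"
    using real_arch_pow[of 2 "4 / \<eta>\<^sup>2"] by auto
  then have "4 < 2 ^ d * \<eta>\<^sup>2" using \<eta>(1) by (simp add: field_simps)
  also have "\<dots> \<le> 2 ^ Suc d * \<eta>\<^sup>2" by (intro mult_right_mono) auto
  finally have d: "4 \<le> 2 ^ Suc d * \<eta>\<^sup>2" by simp
  define K where "K = (2 :: nat) ^ Suc d"
  have K: "K > 0" by (simp add: K_def)
  define r where "r n = 2 powr (- 1 * sqrt (log 2 (log 2 (real n))))" for n :: nat
  have "eventually (\<lambda>n. n > 0 \<and> 1 / sqrt (real n) < \<eta>\<^sup>2 / 2 * r n ^ K) sequentially"
    unfolding r_def using \<eta>(1) K by (intro eventually_conj eventually_gt_at_top eventually_power_bound) auto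
  then obtain N where N: "\<And>n. n \<ge> N \<Longrightarrow> n > 0 \<and> 1 / sqrt (real n) < \<eta>\<^sup>2 / 2 * r n ^ K"
    unfolding eventually_sequentially by blast
  have "tv_dist n (poly_dist m n P) (ber13_prod n) \<ge> 1 - r n"
    if n: "n \<ge> N" and P: "\<forall>i<n. f2_poly_deg_le m 3 (P i)" for n m P
  proof -
    have "\<eta>\<^sup>2 / 2 * overlap m n P ^ K \<le> 1 / sqrt (real n)"
      unfolding K_def using N[OF n] P by (intro overlap_power_le[OF _ _ \<eta>(1) d \<eta>(2)]) auto
    also have "\<dots> < \<eta>\<^sup>2 / 2 * r n ^ K" using N[OF n] by simp
    finally have "overlap m n P ^ K < r n ^ K"
      using \<eta>(1) by (simp add: mult_less_cancel_left_pos)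
    then have "overlap m n P < r n" by (rule power_less_imp_less_base) (simp add: r_def)
    then show ?thesis by (simp add: tv_dist_eq_overlap)
  qed
  \<comment> \<open>The witness c = 1 is the factor written out in \<open>r\<close>.\<close>
  then show ?thesis unfolding r_def by (intro exI[of _ 1] conjI exI[of _ N] allI impI) simp_all
qed

end
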